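(* Consider a sequence of community detection problems with fixed expected total degree, indexed by $N\to\infty$, with parameters $n,p_0',p_1$ (depending on $N$) satisfying the standing assumptions of the context. Assume that $$\frac{n}{\log N}\to\infty \qquad\text{and}\qquad \log\Big(1\vee\frac{1}{np_0'}\Big)=o\Big[\log\Big(\frac Nn\Big)\Big].$$ If $$\frac{p_1-p_0'}{\sqrt{p_0'}}\,\frac{n^{3/2}}{N^{3/4}}\to 0 \qquad\text{and}\qquad \limsup \frac{n\,H_{p_0'}(p_1)}{2\log(N/n)}<1,$$ then all tests are asymptotically powerless for this problem, i.e. $\inf_T\gamma_N'(T)\to1$, where the infimum is over all tests $T$ (equivalently, $\liminf_N\gamma_N'(T_N)\ge1$ for every sequence of tests $(T_N)$).
   Context: Observed data: the adjacency matrix $\boldsymbol{W}=(W_{i,j})\in\{0,1\}^{N\times N}$ (symmetric, zero diagonal) of a random undirected graph on the node set $\{1,\dots,N\}$. Notation: $m^{(2)}=m(m-1)/2$. Fixed expected total degree model: given $0<p_0'\le p_1<1$, set $p_0:=p_0'+(p_1-p_0')\frac{n^{(2)}}{N^{(2)}}$. Under $\mathbb{P}_0$ (null), the $W_{i,j}$, $i<j$, are i.i.d. Bernoulli$(p_0)$. For $S\subset\{1,\dots,N\}$ with $|S|=n$, under $\mathbb{P}'_S$ (alternative), the $W_{i,j}$, $i<j$, are independent, $\mathbb{P}'_S(W_{i,j}=1)=p_1$ if $i,j\in S$, and $=p_0'$ otherwise. A test $T$ is a function of $\boldsymbol{W}$ with values in $\{0,1\}$ (it may depend on $N,n,p_0',p_1$),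 and its risk is $\gamma'_N(T)=\mathbb{P}_0(T=1)+\max_{|S|=n}\mathbb{P}'_S(T=0)$. Entropy function: $H_p(q)=q\log\frac qp+(1-q)\log\frac{1-q}{1-p}$. Standing assumptions: $N\to\infty$; $n,p_0',p_1$ may depend on $N$; $n/N\to0$; $p_0$ is bounded away from $1$; $N^2p_0\to\infty$; and $n\to\infty$ with $n^2p_1\to\infty$. *)

theory Defs
  imports "HOL-Probability.Probability" "HOL-Library.Landau_Symbols"
begin

text \<open>
  A graph on the nodes \<open>1, \<dots>, N\<close> is given by its adjacency matrix, with boolean entries in place of
  \<open>0\<close> and \<open>1\<close>. A test is likewise a boolean function of the matrix, \<open>True\<close> meaning that the null
  hypothesis is rejected.
\<close>

type_synonym adj_matrix = "nat \<Rightarrow> nat \<Rightarrow> bool"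

type_synonym graph_test = "adj_matrix \<Rightarrow> bool"

definition node_pairs :: "nat \<Rightarrow> (nat \<times> nat) set" where
  "node_pairs N = {(i, j). 1 \<le> i \<and> i < j \<and> j \<le> N}"

definition matrix_of_pairs :: "(nat \<times> nat \<Rightarrow> bool) \<Rightarrow> adj_matrix" where
  "matrix_of_pairs x = (\<lambda>i j. if i < j then x (i, j) else if j < i then x (j, i) else False)"

text \<open>
  Independent edges, where \<open>{i, j}\<close> with \<open>i < j\<close> is present with probability \<open>q i j\<close>. Entries with an
  index outside \<open>{1..N}\<close> are \<open>False\<close>.
\<close>

definition random_graph :: "nat \<Rightarrow> (nat \<Rightarrow> nat \<Rightarrow> real) \<Rightarrow> adj_matrix pmf" where
  "random_graph N q =
     map_pmf matrix_of_pairs (Pi_pmf (node_pairs N) False (\<lambda>(i, j). bernoulli_pmf (q i j)))"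

definition num_pairs :: "nat \<Rightarrow> real" where
  "num_pairs m = real m * (real m - 1) / 2"

definition null_prob :: "nat \<Rightarrow> nat \<Rightarrow> real \<Rightarrow> real \<Rightarrow> real" where
  "null_prob N n p0' p1 = p0' + (p1 - p0') * (num_pairs n / num_pairs N)"

definition null_law :: "nat \<Rightarrow> nat \<Rightarrow> real \<Rightarrow> real \<Rightarrow> adj_matrix pmf" where
  "null_law N n p0' p1 = random_graph N (\<lambda>i j. null_prob N n p0' p1)"

definition alt_law :: "nat \<Rightarrow> real \<Rightarrow> real \<Rightarrow> nat set \<Rightarrow> adj_matrix pmf" where
  "alt_law N p0' p1 S = random_graph N (\<lambda>i j. if i \<in> S \<and> j \<in> S then p1 else p0')"

definition test_risk :: "nat \<Rightarrow> nat \<Rightarrow> real \<Rightarrow> real \<Rightarrow> graph_test \<Rightarrow> real" where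
  "test_risk N n p0' p1 T =
     measure_pmf.prob (null_law N n p0' p1) {W. T W} +
     Max ((\<lambda>S. measure_pmf.prob (alt_law N p0' p1 S) {W. \<not> T W}) `
            {S. S \<subseteq> {1..N} \<and> card S = n})"

definition bernoulli_entropy :: "real \<Rightarrow> real \<Rightarrow> real" where
  "bernoulli_entropy p q = q * ln (q / p) + (1 - q) * ln ((1 - q) / (1 - p))"

end

theory Submission
  imports Defs "HOL-Real_Asymp.Real_Asymp"
begin

text \<open>
  The maximal risk over \<open>S\<close> is at least the risk against the uniform mixture over \<open>S\<close>, so it suffices
  that the mixture is asymptotically indistinguishable from the null law, which follows from a truncated
  second moment bound. Write \<open>l = ln (N/n)\<close>, \<open>\<gamma> = (p1 - p0')\<^sup>2/(p0 (1 - p0))\<close>, \<open>m\<^sub>2 = m(m - 1)/2\<close>, and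
  let \<open>k\<close> be the size of the overlap of two independent random node sets.

  Without truncation the second moment is the mean of \<open>exp (\<gamma> (k\<^sub>2 - n\<^sub>2\<^sup>2/N\<^sub>2))\<close>. Matching the expected total
  degrees centres the exponent, since \<open>n\<^sub>2\<^sup>2/N\<^sub>2\<close> is the mean of \<open>k\<^sub>2\<close>. As \<open>k\<^sub>2\<close> fluctuates on the scale
  \<open>n\<^sup>3/N\<^bsup>3/2\<^esup>\<close>, the total degree condition controls the overlaps up to \<open>k \<le> n (n/N)\<^bsup>1/4\<^esup>\<close>. For larger
  overlaps one restricts to graphs in which no subset of \<open>S\<close> of size \<open>k\<close> spans many more than
  \<open>p1 k\<^sub>2\<close> edges. This reduces the second moment to about \<open>exp (k\<^sub>2 H)\<close> with the entropy
  \<open>H\<close>, while such an overlap has probability about \<open>exp (- k l)\<close> up to a factor \<open>(n/k)\<^sup>k\<close>; the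
  entropy condition makes the product summable.
\<close>

section \<open>Edge configurations\<close>

text \<open>Write \<open>p\<close> for \<open>p0'\<close> and \<open>q\<close> for
  \<open>p1\<close>. The cut \<open>n (n/N)^(1/4) = n exp (- l / 4)\<close> balances two demands.
  Below it the pair exponent, about \<open>\<gamma> k\<^sup>2 / 2\<close>, must be a small multiple
  of \<open>k\<close>. The entropy condition bounds \<open>\<gamma> n\<close> by a constant times
  \<open>l q / p\<close>, and the assumption on \<open>ln (max 1 (1 / (n p)))\<close> makes
  \<open>ln (q / p)\<close> a small multiple of \<open>l\<close>, so
  \<open>\<gamma> n exp (- l / 4)\<close> is small. Above the cut
  \<open>ln (n / k) \<le> l / 4\<close>, so the number of \<open>k\<close>-subsets uses up only part
  of the overlap probability.

  The obstacle above the cut is the truncation level. It must exceed the planted mean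
  \<open>q * num_pairs k\<close> by a slack \<open>y k\<close> that survives a union bound over all
  \<open>k\<close>-subsets, yet every unit of slack costs the log odds ratio \<open>\<theta>\<close>
  in the second moment. This ratio is of order \<open>(q - p) / p\<close> when \<open>q\<close> is
  close to \<open>p\<close>, but otherwise may be as large as a small multiple of \<open>l\<close>.
  Hence the two shapes of \<open>y\<close>. The condition on \<open>n / ln N\<close> keeps
  \<open>q\<close> away from \<open>1\<close>, so that non-edges do not inflate
  \<open>\<theta>\<close>.\<close>

definition config_weight :: "'e set \<Rightarrow> ('e \<Rightarrow> real) \<Rightarrow> 'e set \<Rightarrow> real" where
  "config_weight A q X = (\<Prod>e\<in>A. if e \<in> X then q e else 1 - q e)"

text \<open>Expanding the product picks \<open>f e\<close> or \<open>g e\<close> for each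
  \<open>e\<close>. Probabilistically, the expectation of a product over independent edges
  factorises.\<close>

lemma sum_Pow_prod:
  fixes f g :: "'e \<Rightarrow> 'c::comm_semiring_1"
  assumes "finite A"
  shows "(\<Sum>X\<in>Pow A. \<Prod>e\<in>A. if e \<in> X then f e else g e) = (\<Prod>e\<in>A. f e + g e)"
proof -
  have "(\<Prod>e\<in>A. if e \<in> X then f e else g e) = (\<Prod>e\<in>X. f e) * (\<Prod>e\<in>A - X. g e)"
    if "X \<in> Pow A" for X
  proof -
    have "A \<inter> {e. e \<in> X} = X" "A \<inter> - {e. e \<in> X} = A - X" using that by auto
    then show ?thesis using prod.If_cases[OF assms, of "\<lambda>e. e \<in> X" f g] by simp
  qed
  then show ?thesis using prod_add[OF assms, of f g] by simp
qed

lemma sum_config_weight: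
  assumes "finite A" shows "(\<Sum>X\<in>Pow A. config_weight A q X) = 1"
  using sum_Pow_prod[OF assms, of q "\<lambda>e. 1 - q e"] by (simp add: config_weight_def)

lemma config_weight_nonneg:
  assumes "\<And>e. e \<in> A \<Longrightarrow> 0 \<le> q e \<and> q e \<le> 1" shows "config_weight A q X \<ge> 0"
  unfolding config_weight_def by (rule prod_nonneg) (use assms in auto)

lemma config_weight_pos:
  assumes "\<And>e. e \<in> A \<Longrightarrow> 0 < q e \<and> q e < 1" shows "config_weight A q X > 0"
  unfolding config_weight_def by (rule prod_pos) (use assms in auto)

text \<open>The passage from pmfs to finite sums over edge sets. A function that is
  \<open>True\<close> somewhere outside \<open>A\<close> has mass \<open>0\<close> because the
  default value is \<open>False\<close>; all others are indicators of subsets of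
  \<open>A\<close>.\<close>

lemma prob_Pi_bernoulli:
  assumes fin: "finite A" and q: "\<And>e. e \<in> A \<Longrightarrow> 0 \<le> q e \<and> q e \<le> 1"
  shows "measure_pmf.prob (Pi_pmf A False (\<lambda>e. bernoulli_pmf (q e))) {x. P x}
           = (\<Sum>X\<in>{X\<in>Pow A. P (\<lambda>e. e \<in> X)}. config_weight A q X)"
proof -
  let ?p = "Pi_pmf A False (\<lambda>e. bernoulli_pmf (q e))"
  let ?F = "{X\<in>Pow A. P (\<lambda>e. e \<in> X)}"
  let ?i = "\<lambda>X e. e \<in> X"
  have "measure_pmf.prob ?p {x. P x} = measure_pmf.prob ?p (?i ` ?F)"
  proof (rule measure_prob_cong_0)
    fix x assume x: "x \<in> {x. P x} - ?i ` ?F"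
    have "\<not> (\<forall>e. e \<notin> A \<longrightarrow> x e = False)"
    proof
      assume "\<forall>e. e \<notin> A \<longrightarrow> x e = False"
      then have "Collect x \<in> ?F" "x = ?i (Collect x)" using x by auto
      then show False using x by blast
    qed
    then show "pmf ?p x = 0" by (subst pmf_Pi[OF fin]) (simp only: if_False)
  next
    fix x assume "x \<in> ?i ` ?F - {x. P x}" then show "pmf ?p x = 0" by auto
  qed
  also have "\<dots> = (\<Sum>x\<in>?i ` ?F. pmf ?p x)"
    by (rule measure_measure_pmf_finite) (use fin in auto)
  also have "\<dots> = (\<Sum>X\<in>?F. pmf ?p (?i X))"
    by (rule sum.reindex_cong[where l = ?i]) (auto intro!: inj_onI simp: fun_eq_iff)
  also have "\<dots> = (\<Sum>X\<in>?F. config_weight A q X)"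
  proof (rule sum.cong[OF refl])
    fix X assume "X \<in> ?F"
    then have "pmf ?p (?i X) = (\<Prod>e\<in>A. pmf (bernoulli_pmf (q e)) (e \<in> X))"
      by (intro pmf_Pi'[OF fin]) auto
    also have "\<dots> = config_weight A q X"
      unfolding config_weight_def by (rule prod.cong) (use q in auto)
    finally show "pmf ?p (?i X) = config_weight A q X" .
  qed
  finally show ?thesis .
qed

lemma finite_node_pairs: "finite (node_pairs N)"
  by (rule finite_subset[of _ "{1..N} \<times> {1..N}"]) (auto simp: node_pairs_def)

lemma prob_random_graph:
  assumes "\<And>i j. 0 \<le> q i j \<and> q i j \<le> 1"
  shows "measure_pmf.prob (random_graph N q) {W. P W}
    = (\<Sum>X\<in>{X\<in>Pow (node_pairs N). P (matrix_of_pairs (\<lambda>e. e \<in> X))}.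
         config_weight (node_pairs N) (case_prod q) X)"
proof -
  have "(\<lambda>(i, j). bernoulli_pmf (q i j)) = (\<lambda>e. bernoulli_pmf (case_prod q e))"
    by auto
  then have "measure_pmf.prob (random_graph N q) {W. P W} =
     measure_pmf.prob (Pi_pmf (node_pairs N) False (\<lambda>e. bernoulli_pmf (case_prod q e)))
        {x. P (matrix_of_pairs x)}"
    by (simp add: random_graph_def measure_map_pmf vimage_def)
  also have "\<dots> = (\<Sum>X\<in>{X\<in>Pow (node_pairs N). P (matrix_of_pairs (\<lambda>e. e \<in> X))}.
         config_weight (node_pairs N) (case_prod q) X)"
    by (rule prob_Pi_bernoulli) (use assms finite_node_pairs in auto)
  finally show ?thesis .
qed

section \<open>Node pairs inside a node set\<close>

definition inner_pairs :: "nat set \<Rightarrow> (nat \<times> nat) set" where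
  "inner_pairs S = {(i, j). i \<in> S \<and> j \<in> S \<and> i < j}"

lemma finite_inner_pairs: "finite S \<Longrightarrow> finite (inner_pairs S)"
  by (rule finite_subset[of _ "S \<times> S"]) (auto simp: inner_pairs_def)

lemma inner_pairs_Int: "inner_pairs (S \<inter> T) = inner_pairs S \<inter> inner_pairs T"
  by (auto simp: inner_pairs_def)

lemma inner_pairs_mono: "S \<subseteq> T \<Longrightarrow> inner_pairs S \<subseteq> inner_pairs T"
  by (auto simp: inner_pairs_def)

lemma node_pairs_eq_inner_pairs: "node_pairs N = inner_pairs {1..N}"
  by (auto simp: inner_pairs_def node_pairs_def)

text \<open>Nodes are added in increasing order, so the pairs gained with the new maximum
  \<open>b\<close> are exactly the \<open>(i, b)\<close> with \<open>i\<close> in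
  \<open>S\<close>.\<close>

lemma card_inner_pairs:
  assumes "finite S" shows "real (card (inner_pairs S)) = num_pairs (card S)"
  using assms
proof (induction S rule: finite_linorder_max_induct)
  case empty
  then show ?case by (simp add: inner_pairs_def num_pairs_def)
next
  case (insert b S)
  have eq: "inner_pairs (insert b S) = inner_pairs S \<union> (\<lambda>i. (i, b)) ` S"
    using insert.hyps by (force simp: inner_pairs_def)
  have disj: "inner_pairs S \<inter> (\<lambda>i. (i, b)) ` S = {}"
    using insert.hyps by (auto simp: inner_pairs_def)
  have "card (inner_pairs (insert b S)) = card (inner_pairs S) + card S"
    unfolding eq using insert.hyps finite_inner_pairs disj
    by (subst card_Un_disjoint) (auto simp: card_image inj_on_def)
  moreover have "b \<notin> S" using insert.hyps by auto
  ultimately show ?case using insert by (simp add: num_pairs_def field_simps)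
qed

lemma card_node_pairs: "real (card (node_pairs N)) = num_pairs N"
  by (simp add: node_pairs_eq_inner_pairs card_inner_pairs)

text \<open>The pointwise bound is \<open>min(1, u) \<ge> 1 - \<bar>1 - u\<bar>\<close> with
  \<open>\<bar>1 - u\<bar> \<le> t/2 + (1 - u)\<^sup>2/(2 t)\<close>, where \<open>t = sqrt c\<close>; it replaces the Cauchy-Schwarz inequality.\<close>

lemma mixture_testing_bound:
  fixes c :: real and p :: "'x \<Rightarrow> real" and q r :: "'s \<Rightarrow> 'x \<Rightarrow> real"
  assumes fin: "finite \<Omega>" "finite \<S>" "\<S> \<noteq> {}"
    and p: "\<And>x. x \<in> \<Omega> \<Longrightarrow> p x > 0" "(\<Sum>x\<in>\<Omega>. p x) = 1"
    and r: "\<And>S x. S \<in> \<S> \<Longrightarrow> x \<in> \<Omega> \<Longrightarrow> 0 \<le> r S x \<and> r S x \<le> q S x"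
    and c: "c > 0"
    and first: "(\<Sum>S\<in>\<S>. \<Sum>x\<in>\<Omega>. r S x) \<ge> (1 - c) * card \<S>"
    and second: "(\<Sum>S\<in>\<S>. \<Sum>S'\<in>\<S>. \<Sum>x\<in>\<Omega>. r S x * r S' x / p x) \<le> (1 + c) * card \<S> * card \<S>"
    and A: "A \<subseteq> \<Omega>"
  shows "(\<Sum>x\<in>A. p x) + Max ((\<lambda>S. \<Sum>x\<in>\<Omega> - A. q S x) ` \<S>) \<ge> 1 - 2 * sqrt c"
proof -
  define C where "C = real (card \<S>)"
  have C: "C > 0" using fin by (simp add: C_def card_gt_0_iff)
  \<comment> \<open>The mixture of the truncated alternatives. Truncation loses mass, so
    \<open>m\<close> need not sum to \<open>1\<close>; only the lower bound \<open>1 - c\<close> is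
    available.\<close>
  define m where "m x = (\<Sum>S\<in>\<S>. r S x) / C" for x
  define t where "t = sqrt c"
  have t: "t > 0" "t * t = c" using c by (auto simp: t_def)
  let ?Max = "Max ((\<lambda>S. \<Sum>x\<in>\<Omega> - A. q S x) ` \<S>)"
  have "(\<Sum>x\<in>\<Omega> - A. m x) = (\<Sum>S\<in>\<S>. \<Sum>x\<in>\<Omega> - A. r S x) / C"
    unfolding m_def sum_divide_distrib[symmetric] by (subst sum.swap) simp
  also have "\<dots> \<le> (\<Sum>S\<in>\<S>. ?Max) / C"
  proof (intro divide_right_mono sum_mono)
    fix S assume S: "S \<in> \<S>"
    have "(\<Sum>x\<in>\<Omega> - A. r S x) \<le> (\<Sum>x\<in>\<Omega> - A. q S x)" using r S by (intro sum_mono) auto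
    also have "\<dots> \<le> ?Max" using fin S by (intro Max_ge) auto
    finally show "(\<Sum>x\<in>\<Omega> - A. r S x) \<le> ?Max" .
  qed (use C in auto)
  also have "\<dots> = ?Max" using C by (simp add: C_def)
  finally have max: "(\<Sum>x\<in>\<Omega> - A. m x) \<le> ?Max" .
  have m1: "(\<Sum>x\<in>\<Omega>. m x) \<ge> 1 - c"
  proof -
    have "(\<Sum>x\<in>\<Omega>. m x) = (\<Sum>S\<in>\<S>. \<Sum>x\<in>\<Omega>. r S x) / C"
      unfolding m_def sum_divide_distrib[symmetric] by (subst sum.swap) simp
    also have "\<dots> \<ge> 1 - c" using first C by (simp add: C_def[symmetric] pos_le_divide_eq)
    finally show ?thesis .
  qed
  have m2: "(\<Sum>x\<in>\<Omega>. (m x)\<^sup>2 / p x) \<le> 1 + c"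
  proof -
    have "(\<Sum>x\<in>\<Omega>. (m x)\<^sup>2 / p x) = (\<Sum>x\<in>\<Omega>. \<Sum>S\<in>\<S>. \<Sum>S'\<in>\<S>. r S x * r S' x / p x) / (C * C)"
      unfolding sum_divide_distrib
      by (rule sum.cong) (simp_all add: m_def power2_eq_square sum_product sum_divide_distrib ac_simps)
    also have "(\<Sum>x\<in>\<Omega>. \<Sum>S\<in>\<S>. \<Sum>S'\<in>\<S>. r S x * r S' x / p x) =
        (\<Sum>S\<in>\<S>. \<Sum>S'\<in>\<S>. \<Sum>x\<in>\<Omega>. r S x * r S' x / p x)"
      by (subst sum.swap, intro sum.cong refl, subst sum.swap, simp)
    also have "\<dots> / (C * C) \<le> 1 + c"
      using second C by (simp add: C_def[symmetric] pos_divide_le_eq mult.assoc)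
    finally show ?thesis .
  qed
  have pt: "(if x \<in> A then p x else m x) \<ge> p x - (t / 2 * p x + (p x - 2 * m x + (m x)\<^sup>2 / p x) / (2 * t))"
    if x: "x \<in> \<Omega>" for x
  proof -
    have px: "p x > 0" using p x by auto
    have "0 \<le> p x * (t - (1 - m x / p x))\<^sup>2 / (2 * t)" "0 \<le> p x * (t + (1 - m x / p x))\<^sup>2 / (2 * t)"
      using px t by auto
    moreover have "p x * (t - (1 - m x / p x))\<^sup>2 / (2 * t) =
      (t / 2 * p x + (p x - 2 * m x + (m x)\<^sup>2 / p x) / (2 * t)) - (p x - m x)"
      using px t by (simp add: power2_eq_square field_simps)
    moreover have "p x * (t + (1 - m x / p x))\<^sup>2 / (2 * t) =
      (t / 2 * p x + (p x - 2 * m x + (m x)\<^sup>2 / p x) / (2 * t)) + (p x - m x)"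
      using px t by (simp add: power2_eq_square field_simps)
    moreover have "m x \<ge> 0" unfolding m_def using r x C by (auto intro!: sum_nonneg divide_nonneg_nonneg)
    ultimately show ?thesis by auto
  qed
  \<comment> \<open>The defect of the mass and the excess of the second moment add up to a squared
    distance of at most \<open>3 * c\<close>. With \<open>t = sqrt c\<close> the total loss is
    \<open>t / 2 + 3 * t / 2 = 2 * t\<close>.\<close>
  have "1 - (t / 2 + (1 - 2 * (1 - c) + (1 + c)) / (2 * t)) \<le>
      1 - (t / 2 + (1 - 2 * (\<Sum>x\<in>\<Omega>. m x) + (\<Sum>x\<in>\<Omega>. (m x)\<^sup>2 / p x)) / (2 * t))"
    using m1 m2 t by (auto intro!: divide_right_mono)
  also have "\<dots> = (\<Sum>x\<in>\<Omega>. p x - (t / 2 * p x + (p x - 2 * m x + (m x)\<^sup>2 / p x) / (2 * t)))"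
    by (simp add: sum_subtractf sum.distrib sum_divide_distrib[symmetric] sum_distrib_left[symmetric] p)
  also have "\<dots> \<le> (\<Sum>x\<in>\<Omega>. if x \<in> A then p x else m x)" by (intro sum_mono pt)
  also have "\<dots> = (\<Sum>x\<in>A. p x) + (\<Sum>x\<in>\<Omega> - A. m x)"
  proof -
    have "\<Omega> \<inter> {x. x \<in> A} = A" "\<Omega> \<inter> - {x. x \<in> A} = \<Omega> - A" using A by auto
    then show ?thesis using sum.If_cases[OF fin(1), of "\<lambda>x. x \<in> A" p m] by simp
  qed
  also have "1 - (t / 2 + (1 - 2 * (1 - c) + (1 + c)) / (2 * t)) = 1 - 2 * t"
    using t by (auto simp: field_simps)
  finally show ?thesis using max by (simp add: t_def)
qed

section \<open>Second moments of the likelihood ratio\<close>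

definition planted_prob :: "real \<Rightarrow> real \<Rightarrow> 'e set \<Rightarrow> 'e \<Rightarrow> real" where
  "planted_prob p q B e = (if e \<in> B then q else p)"

lemma config_weight_mult_div:
  "config_weight A a X * config_weight A b X / config_weight A (\<lambda>_. r) X =
     (\<Prod>e\<in>A. if e \<in> X then a e * b e / r else (1 - a e) * (1 - b e) / (1 - r))"
  unfolding config_weight_def prod.distrib[symmetric] prod_dividef[symmetric]
  by (rule prod.cong) auto

lemma bernoulli_second_moment:
  fixes a b r :: real
  assumes "0 < r" "r < 1"
  shows "a * b / r + (1 - a) * (1 - b) / (1 - r) = 1 + (a - r) * (b - r) / (r * (1 - r))"
  using assms by (simp add: field_simps)

lemma prod_bernoulli_second_moment_le:
  fixes a b :: "'e \<Rightarrow> real"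
  assumes r: "0 < r" "r < 1"
    and ab: "\<And>e. e \<in> A \<Longrightarrow> 0 \<le> a e \<and> a e \<le> 1 \<and> 0 \<le> b e \<and> b e \<le> 1"
    and fin: "finite A"
  shows "(\<Prod>e\<in>A. a e * b e / r + (1 - a e) * (1 - b e) / (1 - r))
           \<le> exp ((\<Sum>e\<in>A. (a e - r) * (b e - r)) / (r * (1 - r)))"
proof -
  have "(\<Prod>e\<in>A. a e * b e / r + (1 - a e) * (1 - b e) / (1 - r))
      \<le> (\<Prod>e\<in>A. exp ((a e - r) * (b e - r) / (r * (1 - r))))"
  proof (rule prod_mono, intro conjI)
    fix e assume e: "e \<in> A"
    show "0 \<le> a e * b e / r + (1 - a e) * (1 - b e) / (1 - r)"
      using r ab[OF e] by simp
    show "a e * b e / r + (1 - a e) * (1 - b e) / (1 - r) \<le> exp ((a e - r) * (b e - r) / (r * (1 - r)))"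
      unfolding bernoulli_second_moment[OF r] by (rule exp_ge_add_one_self)
  qed
  also have "\<dots> = exp ((\<Sum>e\<in>A. (a e - r) * (b e - r)) / (r * (1 - r)))"
    using fin by (simp add: exp_sum sum_divide_distrib)
  finally show ?thesis .
qed

lemma sum_centred_indicators:
  fixes \<rho> :: real
  assumes "finite A" "B \<subseteq> A" "C \<subseteq> A"
  shows "(\<Sum>e\<in>A. (of_bool (e \<in> B) - \<rho>) * (of_bool (e \<in> C) - \<rho>))
     = card (B \<inter> C) - \<rho> * card B - \<rho> * card C + \<rho>\<^sup>2 * card A"
proof -
  have "(\<Sum>e\<in>A. (of_bool (e \<in> B) - \<rho>) * (of_bool (e \<in> C) - \<rho>))
     = (\<Sum>e\<in>A. of_bool (e \<in> B \<inter> C) - \<rho> * of_bool (e \<in> B) - \<rho> * of_bool (e \<in> C) + \<rho>\<^sup>2)"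
    by (rule sum.cong) (auto simp: power2_eq_square algebra_simps)
  also have "\<dots> = card (A \<inter> (B \<inter> C)) - \<rho> * card (A \<inter> B) - \<rho> * card (A \<inter> C) + \<rho>\<^sup>2 * card A"
  proof -
    have *: "(\<Sum>e\<in>A. of_bool (e \<in> D)) = real (card (A \<inter> D))" for D
      using assms(1) by (simp add: of_bool_def sum.If_cases Int_def)
    show ?thesis by (simp add: sum.distrib sum_subtractf sum_distrib_left[symmetric] * del: of_bool_conj Int_iff)
  qed
  finally show ?thesis using assms by (simp add: Int_absorb1 le_infI1)
qed

text \<open>\<open>B\<close> and \<open>C\<close> will be the pairs inside two candidate node sets.
  As \<open>\<rho>\<close> is the fraction of planted pairs, \<open>p0\<close> is the average
  planted edge probability over \<open>A\<close>; this expresses the matching of expected total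
  degrees.\<close>

locale planted_pair =
  fixes A B C :: "'e set" and b :: nat and p q \<rho> p0 :: real
  assumes fin: "finite A" and sub: "B \<subseteq> A" "C \<subseteq> A"
    and card: "card B = b" "card C = b" and A_pos: "card A > 0"
    and pq: "0 < p" "p \<le> q" "q < 1"
    and rho: "\<rho> = b / card A" and p0: "p0 = p + (q - p) * \<rho>"
begin

text \<open>The product of the two likelihood ratios against the null, times the null weight of
  \<open>X\<close>; its sum over \<open>X\<close> is a mixed second moment under the null.\<close>

definition ratio_sq :: "'e set \<Rightarrow> real" where
  "ratio_sq X = config_weight A (planted_prob p q B) X * config_weight A (planted_prob p q C) X
       / config_weight A (\<lambda>_. p0) X"

lemma rho_bounds: "0 \<le> \<rho>" "\<rho> \<le> 1"
  using card_mono[OF fin sub(1)] card A_pos by (auto simp: rho divide_le_eq_1)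

lemma p0_bounds: "p \<le> p0" "p0 \<le> q" "0 < p0" "p0 < 1"
proof -
  show 1: "p \<le> p0" using pq rho_bounds by (simp add: p0)
  have "(q - p) * \<rho> \<le> (q - p) * 1" using pq rho_bounds by (intro mult_left_mono) auto
  then show 2: "p0 \<le> q" by (simp add: p0)
  show "0 < p0" "p0 < 1" using 1 2 pq by auto
qed

lemma planted_centred: "planted_prob p q D e - p0 = (q - p) * (of_bool (e \<in> D) - \<rho>)"
  by (simp add: planted_prob_def p0 algebra_simps)

lemma planted_range: "0 \<le> planted_prob p q D e" "planted_prob p q D e \<le> 1"
  using pq by (auto simp: planted_prob_def)

text \<open>With \<open>\<rho> = b / card A\<close> the two linear terms and the constant collapse
  to \<open>- b\<^sup>2 / card A\<close>. This is the centring that the degree matching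
  buys.\<close>

lemma centred_sum:
  "(\<Sum>e\<in>A. (planted_prob p q B e - p0) * (planted_prob p q C e - p0))
     = (q - p)\<^sup>2 * (card (B \<inter> C) - real b ^ 2 / card A)"
proof -
  have "(\<Sum>e\<in>A. (planted_prob p q B e - p0) * (planted_prob p q C e - p0))
     = (q - p)\<^sup>2 * (\<Sum>e\<in>A. (of_bool (e \<in> B) - \<rho>) * (of_bool (e \<in> C) - \<rho>))"
    unfolding planted_centred sum_distrib_left by (simp add: power2_eq_square ac_simps)
  also have "(\<Sum>e\<in>A. (of_bool (e \<in> B) - \<rho>) * (of_bool (e \<in> C) - \<rho>))
      = card (B \<inter> C) - real b ^ 2 / card A"
    using A_pos unfolding sum_centred_indicators[OF fin sub] card rho
    by (simp add: power2_eq_square field_simps)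
  finally show ?thesis .
qed

text \<open>Independence factorises the sum over edges; each factor has the form
  \<open>1 + x\<close> and is bounded by \<open>exp x\<close>.\<close>

lemma second_moment:
  "(\<Sum>X\<in>Pow A. ratio_sq X)
     \<le> exp ((q - p)\<^sup>2 / (p0 * (1 - p0)) * (card (B \<inter> C) - real b ^ 2 / card A))"
proof -
  have "(\<Sum>X\<in>Pow A. ratio_sq X) = (\<Prod>e\<in>A. planted_prob p q B e * planted_prob p q C e / p0 +
      (1 - planted_prob p q B e) * (1 - planted_prob p q C e) / (1 - p0))"
    unfolding ratio_sq_def config_weight_mult_div by (rule sum_Pow_prod[OF fin])
  also have "\<dots> \<le> exp ((\<Sum>e\<in>A. (planted_prob p q B e - p0) * (planted_prob p q C e - p0)) / (p0 * (1 - p0)))"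
    by (rule prod_bernoulli_second_moment_le) (use p0_bounds planted_range fin in auto)
  finally show ?thesis by (simp add: centred_sum)
qed

text \<open>On the truncation event one of the two likelihood ratios over the common edges \<open>B \<inter> C\<close> is
  bounded by its maximum; the other one turns the null weights of these edges into planted weights,
  which sum to \<open>1\<close>.\<close>

lemma truncated_second_moment:
  fixes w :: real
  defines "\<theta> \<equiv> ln (q / p0) + ln ((1 - p0) / (1 - q))" and "\<Lambda> \<equiv> ln ((1 - p0) / (1 - q))"
  shows "(\<Sum>X\<in>{X\<in>Pow A. real (card (X \<inter> (B \<inter> C))) \<le> w}. ratio_sq X)
     \<le> exp (\<theta> * w - \<Lambda> * card (B \<inter> C) + (q - p)\<^sup>2 / (p0 * (1 - p0)) * \<rho> * card (B \<inter> C))"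
proof -
  let ?T = "B \<inter> C" and ?l = "(q - p)\<^sup>2 / (p0 * (1 - p0))"
  \<comment> \<open>On a common edge the null weight times one likelihood ratio is the planted
    weight, so \<open>f\<close> and \<open>g\<close> add up to \<open>1\<close> there. Elsewhere
    both ratios are kept.\<close>
  define f where "f e = (if e \<in> ?T then q else planted_prob p q B e * planted_prob p q C e / p0)" for e
  define g where "g e = (if e \<in> ?T then 1 - q else
      (1 - planted_prob p q B e) * (1 - planted_prob p q C e) / (1 - p0))" for e
  define G where "G X = (\<Prod>e\<in>A. if e \<in> X then f e else g e)" for X
  have fg: "0 \<le> f e" "0 \<le> g e" for e
    using pq p0_bounds planted_range
    by (auto simp: f_def g_def intro!: divide_nonneg_nonneg mult_nonneg_nonneg)
  have finT: "finite ?T" using fin sub finite_subset by blast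
  have q1: "0 < q / p0" "0 < (1 - p0) / (1 - q)" using pq p0_bounds by auto
  have \<theta>: "\<theta> \<ge> 0" unfolding \<theta>_def using pq p0_bounds by (intro add_nonneg_nonneg ln_ge_zero) auto
  \<comment> \<open>One likelihood ratio is peeled off on every common edge:
    \<open>exp (\<theta> - \<Lambda>)\<close> if the edge is present and
    \<open>exp (- \<Lambda>)\<close> if it is absent.\<close>
  have split: "ratio_sq X = exp (\<theta> * card (X \<inter> ?T) - \<Lambda> * card ?T) * G X" if "X \<in> Pow A" for X
  proof -
    let ?h = "\<lambda>e. if e \<in> ?T then (if e \<in> X then q / p0 else (1 - q) / (1 - p0)) else 1"
    have "ratio_sq X = (\<Prod>e\<in>A. ?h e * (if e \<in> X then f e else g e))"
      unfolding ratio_sq_def config_weight_mult_div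
      by (rule prod.cong) (auto simp: f_def g_def planted_prob_def)
    also have "\<dots> = (\<Prod>e\<in>A. ?h e) * G X" by (simp add: prod.distrib G_def)
    also have "(\<Prod>e\<in>A. ?h e) = (\<Prod>e\<in>?T. ?h e)"
      by (rule prod.mono_neutral_right) (use fin sub in auto)
    also have "\<dots> = (\<Prod>e\<in>?T. exp (\<theta> * of_bool (e \<in> X) - \<Lambda>))"
    proof (rule prod.cong[OF refl])
      fix e assume "e \<in> ?T"
      moreover have "exp (- \<Lambda>) = (1 - q) / (1 - p0)"
        unfolding \<Lambda>_def exp_minus using q1 by (simp add: exp_ln)
      moreover have "exp (\<theta> - \<Lambda>) = q / p0"
        unfolding \<Lambda>_def \<theta>_def using q1 by (simp add: exp_ln)
      ultimately show "?h e = exp (\<theta> * of_bool (e \<in> X) - \<Lambda>)" by auto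
    qed
    also have "\<dots> = exp (\<Sum>e\<in>?T. \<theta> * of_bool (e \<in> X) - \<Lambda>)" using finT by (simp add: exp_sum)
    also have "(\<Sum>e\<in>?T. \<theta> * of_bool (e \<in> X) - \<Lambda>) = \<theta> * (\<Sum>e\<in>?T. of_bool (e \<in> X)) - \<Lambda> * card ?T"
      by (simp add: sum_subtractf sum_distrib_left[symmetric])
    also have "(\<Sum>e\<in>?T. of_bool (e \<in> X)) = real (card (X \<inter> ?T))"
      using finT by (simp add: of_bool_def sum.If_cases Int_commute Int_def conj_ac)
    finally show ?thesis .
  qed
  have "(\<Sum>X\<in>{X\<in>Pow A. real (card (X \<inter> ?T)) \<le> w}. ratio_sq X)
      \<le> (\<Sum>X\<in>{X\<in>Pow A. real (card (X \<inter> ?T)) \<le> w}. exp (\<theta> * w - \<Lambda> * card ?T) * G X)"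
  proof (rule sum_mono)
    fix X assume X: "X \<in> {X\<in>Pow A. real (card (X \<inter> ?T)) \<le> w}"
    have "G X \<ge> 0" unfolding G_def by (intro prod_nonneg) (use fg in auto)
    moreover have "exp (\<theta> * card (X \<inter> ?T) - \<Lambda> * card ?T) \<le> exp (\<theta> * w - \<Lambda> * card ?T)"
      using X \<theta> by (simp add: mult_left_mono)
    ultimately show "ratio_sq X \<le> exp (\<theta> * w - \<Lambda> * card ?T) * G X"
      using split X by (auto intro: mult_right_mono)
  qed
  also have "\<dots> \<le> (\<Sum>X\<in>Pow A. exp (\<theta> * w - \<Lambda> * card ?T) * G X)"
  proof (rule sum_mono2)
    fix X have "G X \<ge> 0" unfolding G_def by (intro prod_nonneg) (use fg in auto)
    then show "0 \<le> exp (\<theta> * w - \<Lambda> * card ?T) * G X" by simp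
  qed (use fin in auto)
  also have "\<dots> = exp (\<theta> * w - \<Lambda> * card ?T) * (\<Prod>e\<in>A. f e + g e)"
    unfolding sum_distrib_left[symmetric] G_def sum_Pow_prod[OF fin] ..
  also have "(\<Prod>e\<in>A. f e + g e) = (\<Prod>e\<in>A - ?T. f e + g e)"
    by (rule prod.mono_neutral_right) (use fin sub in \<open>auto simp: f_def g_def\<close>)
  also have "\<dots> = (\<Prod>e\<in>A - ?T. planted_prob p q B e * planted_prob p q C e / p0 +
      (1 - planted_prob p q B e) * (1 - planted_prob p q C e) / (1 - p0))"
    by (rule prod.cong) (auto simp: f_def g_def)
  also have "exp (\<theta> * w - \<Lambda> * card ?T) * \<dots> \<le> exp (\<theta> * w - \<Lambda> * card ?T) *
      exp ((\<Sum>e\<in>A - ?T. (planted_prob p q B e - p0) * (planted_prob p q C e - p0)) / (p0 * (1 - p0)))"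
    by (intro mult_left_mono prod_bernoulli_second_moment_le) (use p0_bounds planted_range fin in auto)
  also have "(\<Sum>e\<in>A - ?T. (planted_prob p q B e - p0) * (planted_prob p q C e - p0))
     = (q - p)\<^sup>2 * (card ?T - real b ^ 2 / card A - (1 - \<rho>)\<^sup>2 * card ?T)"
  proof -
    have "(\<Sum>e\<in>?T. (planted_prob p q B e - p0) * (planted_prob p q C e - p0))
        = (\<Sum>e\<in>?T. (q - p)\<^sup>2 * (1 - \<rho>)\<^sup>2)"
      by (rule sum.cong) (auto simp: planted_centred power2_eq_square)
    moreover have "(\<Sum>e\<in>A - ?T. (planted_prob p q B e - p0) * (planted_prob p q C e - p0))
      = (\<Sum>e\<in>A. (planted_prob p q B e - p0) * (planted_prob p q C e - p0))
       - (\<Sum>e\<in>?T. (planted_prob p q B e - p0) * (planted_prob p q C e - p0))"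
      by (rule sum_diff) (use fin sub in auto)
    ultimately show ?thesis unfolding centred_sum by (simp add: right_diff_distrib ac_simps)
  qed
  also have "exp (\<theta> * w - \<Lambda> * card ?T) * exp ((q - p)\<^sup>2 * (card ?T - real b ^ 2 / card A - (1 - \<rho>)\<^sup>2 * card ?T) / (p0 * (1 - p0)))
     \<le> exp (\<theta> * w - \<Lambda> * card ?T + ?l * \<rho> * card ?T)"
  proof -
    \<comment> \<open>The edges outside \<open>?T\<close> contribute
      \<open>1 - (1 - \<rho>)\<^sup>2 \<le> 2 * \<rho>\<close> per common edge, and the centring
      \<open>\<rho> * b\<close> removes at least one of these two \<open>\<rho>\<close>.\<close>
    have "card ?T \<le> b" using card_mono[of B ?T] fin sub card finite_subset by fastforce
    then have "\<rho> * card ?T \<le> \<rho> * b" using rho_bounds by (intro mult_left_mono) auto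
    moreover have "real b ^ 2 / card A = \<rho> * b" by (simp add: rho power2_eq_square)
    moreover have "0 \<le> \<rho>\<^sup>2 * card ?T" by simp
    ultimately have "card ?T - real b ^ 2 / card A - (1 - \<rho>)\<^sup>2 * card ?T \<le> \<rho> * card ?T"
      by (simp add: power2_eq_square algebra_simps)
    then have "?l * (card ?T - real b ^ 2 / card A - (1 - \<rho>)\<^sup>2 * card ?T) \<le> ?l * (\<rho> * card ?T)"
      using p0_bounds by (intro mult_left_mono) auto
    then show ?thesis by (simp add: exp_add[symmetric] mult.assoc)
  qed
  finally show ?thesis .
qed

end

text \<open>Exponential Markov inequality. Since \<open>T\<close> lies in \<open>B\<close>, its
  edges all have probability \<open>q\<close>, and \<open>1 + x \<le> exp x\<close> turns the
  binomial generating function into the Poisson one.\<close>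

lemma chernoff_planted:
  fixes w s :: real
  assumes fin: "finite A" and T: "T \<subseteq> B" "B \<subseteq> A" and pq: "0 \<le> p" "p \<le> 1" "0 \<le> q" "q \<le> 1" and s: "s \<ge> 0"
  shows "(\<Sum>X\<in>{X\<in>Pow A. real (card (X \<inter> T)) > w}. config_weight A (planted_prob p q B) X)
    \<le> exp (- s * w + q * card T * (exp s - 1))"
proof -
  let ?a = "planted_prob p q B" and ?c = "\<lambda>e. if e \<in> T then exp s else 1"
  have a: "0 \<le> ?a e" "?a e \<le> 1" for e using pq by (auto simp: planted_prob_def)
  have TA: "T \<subseteq> A" using T by auto
  have finT: "finite T" using fin TA finite_subset by blast
  have tilt: "config_weight A ?a X * exp (s * card (X \<inter> T)) = (\<Prod>e\<in>A. if e \<in> X then ?a e * ?c e else 1 - ?a e)"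
    if "X \<in> Pow A" for X
  proof -
    have "exp (s * card (X \<inter> T)) = (\<Prod>e\<in>X \<inter> T. exp s)" by (simp add: exp_of_nat2_mult)
    also have "\<dots> = (\<Prod>e\<in>A. if e \<in> X then ?c e else 1)"
      by (rule prod.mono_neutral_cong_left) (use fin that in auto)
    finally show ?thesis
      unfolding config_weight_def by (simp add: prod.distrib[symmetric] if_distrib cong: if_cong) (rule prod.cong, auto)
  qed
  have "(\<Sum>X\<in>{X\<in>Pow A. real (card (X \<inter> T)) > w}. config_weight A ?a X)
     \<le> (\<Sum>X\<in>{X\<in>Pow A. real (card (X \<inter> T)) > w}. config_weight A ?a X * exp (s * card (X \<inter> T)) * exp (- s * w))"
  proof (rule sum_mono)
    fix X assume "X \<in> {X\<in>Pow A. real (card (X \<inter> T)) > w}"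
    then have "0 \<le> s * card (X \<inter> T) + (- s * w)" using s by (simp add: mult_left_mono)
    then have "1 \<le> exp (s * card (X \<inter> T)) * exp (- s * w)" by (simp add: exp_add[symmetric])
    then show "config_weight A ?a X \<le> config_weight A ?a X * exp (s * card (X \<inter> T)) * exp (- s * w)"
      using config_weight_nonneg[of A ?a X] a by (simp add: mult.assoc mult_le_cancel_left1)
  qed
  also have "\<dots> \<le> (\<Sum>X\<in>Pow A. config_weight A ?a X * exp (s * card (X \<inter> T)) * exp (- s * w))"
    by (rule sum_mono2) (use fin a config_weight_nonneg[of A ?a] in auto)
  also have "\<dots> = (\<Sum>X\<in>Pow A. \<Prod>e\<in>A. if e \<in> X then ?a e * ?c e else 1 - ?a e) * exp (- s * w)"
    unfolding sum_distrib_right[symmetric] using tilt by simp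
  also have "\<dots> = (\<Prod>e\<in>A. ?a e * ?c e + (1 - ?a e)) * exp (- s * w)"
    by (simp add: sum_Pow_prod[OF fin])
  also have "(\<Prod>e\<in>A. ?a e * ?c e + (1 - ?a e)) = (\<Prod>e\<in>T. 1 + q * (exp s - 1))"
    by (rule prod.mono_neutral_cong_right) (use fin T TA in \<open>auto simp: planted_prob_def algebra_simps\<close>)
  also have "\<dots> = (1 + q * (exp s - 1)) ^ card T" by simp
  also have "\<dots> \<le> exp (q * (exp s - 1)) ^ card T"
    using pq s by (intro power_mono exp_ge_add_one_self add_nonneg_nonneg mult_nonneg_nonneg) auto
  also have "\<dots> = exp (q * card T * (exp s - 1))" by (simp add: exp_of_nat_mult[symmetric] ac_simps)
  finally show ?thesis by (simp add: exp_add[symmetric] add.commute)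
qed

section \<open>The overlap of two random node sets\<close>

definition subsets_of_size :: "nat \<Rightarrow> nat \<Rightarrow> nat set set" where
  "subsets_of_size N n = {S. S \<subseteq> {1..N} \<and> card S = n}"

lemma finite_subsets_of_size: "finite (subsets_of_size N n)"
  by (rule finite_subset[of _ "Pow {1..N}"]) (auto simp: subsets_of_size_def)

lemma card_subsets_of_size: "card (subsets_of_size N n) = N choose n"
  using n_subsets[of "{1..N}" n] by (simp add: subsets_of_size_def)

lemma card_supersets_of_size:
  assumes U: "finite U" "T \<subseteq> U" and n: "card T \<le> n"
  shows "card {S. T \<subseteq> S \<and> S \<subseteq> U \<and> card S = n} = (card U - card T) choose (n - card T)"
proof -
  have finT: "finite T" using U finite_subset by blast
  have "bij_betw (\<lambda>S. S \<union> T) {S. S \<subseteq> U - T \<and> card S = n - card T} {S. T \<subseteq> S \<and> S \<subseteq> U \<and> card S = n}"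
  proof (rule bij_betwI[where g = "\<lambda>S. S - T"])
    show "(\<lambda>S. S \<union> T) \<in> {S. S \<subseteq> U - T \<and> card S = n - card T} \<rightarrow> {S. T \<subseteq> S \<and> S \<subseteq> U \<and> card S = n}"
    proof
      fix S assume S: "S \<in> {S. S \<subseteq> U - T \<and> card S = n - card T}"
      then have "finite S" "S \<inter> T = {}" using U finite_subset by blast+
      then show "S \<union> T \<in> {S. T \<subseteq> S \<and> S \<subseteq> U \<and> card S = n}"
        using S U n finT by (auto simp: card_Un_disjoint)
    qed
    show "(\<lambda>S. S - T) \<in> {S. T \<subseteq> S \<and> S \<subseteq> U \<and> card S = n} \<rightarrow> {S. S \<subseteq> U - T \<and> card S = n - card T}"
      using finT by (auto simp: card_Diff_subset)
  qed auto
  then have "card {S. T \<subseteq> S \<and> S \<subseteq> U \<and> card S = n} = card {S. S \<subseteq> U - T \<and> card S = n - card T}"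
    by (simp add: bij_betw_same_card)
  also have "\<dots> = card (U - T) choose (n - card T)" using U by (intro n_subsets) auto
  finally show ?thesis using U finT by (simp add: card_Diff_subset)
qed

text \<open>The probability that a uniform \<open>n\<close>-subset contains a given
  \<open>t\<close>-set is a product of factors \<open>(n - j) / (N - j)\<close>, each at most
  \<open>n / N\<close>.\<close>

lemma binomial_diff_le:
  assumes "t \<le> n" "n \<le> N"
  shows "real ((N - t) choose (n - t)) \<le> (real n / real N) ^ t * real (N choose n)"
  using assms
proof (induction t)
  case (Suc t)
  then have lt: "t < n" "t < N" by auto
  have "Suc (n - Suc t) * (Suc (N - Suc t) choose Suc (n - Suc t)) = Suc (N - Suc t) * ((N - Suc t) choose (n - Suc t))"
    by (rule Suc_times_binomial)
  then have "(n - t) * ((N - t) choose (n - t)) = (N - t) * ((N - Suc t) choose (n - Suc t))"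
    using lt by (simp add: Suc_diff_Suc)
  then have "real (n - t) * real ((N - t) choose (n - t)) = real (N - t) * real ((N - Suc t) choose (n - Suc t))"
    by (metis of_nat_mult)
  then have "real ((N - Suc t) choose (n - Suc t)) = (real (n - t) / real (N - t)) * real ((N - t) choose (n - t))"
    using lt by (simp add: field_simps)
  also have "\<dots> \<le> (real n / real N) * real ((N - t) choose (n - t))"
  proof (rule mult_right_mono)
    have "real t * real n \<le> real t * real N" using Suc.prems by (intro mult_left_mono) auto
    then show "real (n - t) / real (N - t) \<le> real n / real N"
      using lt by (simp add: of_nat_diff divide_simps) (simp add: algebra_simps)
  qed simp
  also have "\<dots> \<le> (real n / real N) * ((real n / real N) ^ t * real (N choose n))"
    using Suc by (intro mult_left_mono) auto
  finally show ?case by simp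
qed simp

text \<open>Hypergeometric overlaps are compared with binomial ones without a coupling. Expanding
  \<open>exp (s K)\<close>, with \<open>K\<close> the overlap, as a product of \<open>1 + z\<close>
  over the common nodes, where \<open>z = exp s - 1\<close>, gives a sum over subsets
  \<open>T\<close> of \<open>S0\<close> with nonnegative coefficients; each probability of
  \<open>T \<subseteq> S\<close> is at most \<open>(n / N) ^ card T\<close>, and the sum closes up
  again to \<open>(1 + z n / N) ^ n\<close>.\<close>

lemma overlap_mgf:
  fixes s :: real
  assumes S0: "S0 \<in> subsets_of_size N n" and s: "s \<ge> 0"
  shows "(\<Sum>S\<in>subsets_of_size N n. exp (s * card (S0 \<inter> S)))
           \<le> real (N choose n) * exp (real n ^ 2 / real N * (exp s - 1))"
proof -
  let ?\<S> = "subsets_of_size N n" and ?z = "exp s - 1"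
  have z: "?z \<ge> 0" using s by simp
  have S0': "S0 \<subseteq> {1..N}" "card S0 = n" "finite S0"
    using S0 finite_subset by (auto simp: subsets_of_size_def)
  have nN: "n \<le> N" using card_mono[OF _ S0'(1)] S0' by simp
  have expand: "exp (s * card (S0 \<inter> S)) = (\<Sum>T\<in>Pow S0. ?z ^ card T * of_bool (T \<subseteq> S))" for S
  proof -
    have "exp (s * card (S0 \<inter> S)) = (\<Prod>i\<in>S0 \<inter> S. exp s)" by (simp add: exp_of_nat2_mult)
    also have "\<dots> = (\<Prod>i\<in>S0. ?z * of_bool (i \<in> S) + 1)"
      by (rule prod.mono_neutral_cong_left) (use S0' in auto)
    also have "\<dots> = (\<Sum>T\<in>Pow S0. \<Prod>i\<in>T. ?z * of_bool (i \<in> S))"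
      by (simp add: prod_add[OF S0'(3)])
    also have "\<dots> = (\<Sum>T\<in>Pow S0. ?z ^ card T * of_bool (T \<subseteq> S))"
    proof (rule sum.cong[OF refl])
      fix T assume "T \<in> Pow S0"
      then have fT: "finite T" using S0' finite_subset by auto
      show "(\<Prod>i\<in>T. ?z * of_bool (i \<in> S)) = ?z ^ card T * of_bool (T \<subseteq> S)"
      proof (cases "T \<subseteq> S")
        case True
        then have "(\<Prod>i\<in>T. ?z * of_bool (i \<in> S)) = (\<Prod>i\<in>T. ?z)" by (intro prod.cong) auto
        then show ?thesis using True by simp
      next
        case False
        then show ?thesis using fT by (auto simp: prod_zero_iff)
      qed
    qed
    finally show ?thesis .
  qed
  have "(\<Sum>S\<in>?\<S>. exp (s * card (S0 \<inter> S))) = (\<Sum>T\<in>Pow S0. ?z ^ card T * (\<Sum>S\<in>?\<S>. of_bool (T \<subseteq> S)))"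
    unfolding expand sum_distrib_left by (rule sum.swap)
  also have "\<dots> \<le> (\<Sum>T\<in>Pow S0. ?z ^ card T * ((real n / real N) ^ card T * real (N choose n)))"
  proof (intro sum_mono mult_left_mono)
    fix T assume "T \<in> Pow S0"
    then have T: "T \<subseteq> {1..N}" "card T \<le> n" using S0' card_mono[of S0 T] by auto
    have "(\<Sum>S\<in>?\<S>. of_bool (T \<subseteq> S)) = real (card {S. T \<subseteq> S \<and> S \<subseteq> {1..N} \<and> card S = n})"
      using finite_subsets_of_size[of N n]
      by (simp add: of_bool_def sum.If_cases subsets_of_size_def Int_def conj_ac)
    also have "\<dots> = real ((N - card T) choose (n - card T))"
      using T by (subst card_supersets_of_size) auto
    also have "\<dots> \<le> (real n / real N) ^ card T * real (N choose n)"
      by (rule binomial_diff_le) (use T nN in auto)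
    finally show "(\<Sum>S\<in>?\<S>. of_bool (T \<subseteq> S)) \<le> (real n / real N) ^ card T * real (N choose n)" .
  qed (use z in simp)
  also have "\<dots> = real (N choose n) * (\<Sum>T\<in>Pow S0. \<Prod>i\<in>T. ?z * (real n / real N))"
    unfolding sum_distrib_left by (rule sum.cong) (simp_all only: power_mult_distrib prod_constant mult_ac)
  also have "(\<Sum>T\<in>Pow S0. \<Prod>i\<in>T. ?z * (real n / real N)) = (1 + ?z * (real n / real N)) ^ n"
    using prod_add[OF S0'(3), of "\<lambda>_. ?z * (real n / real N)" "\<lambda>_. 1"] S0' by (simp add: add.commute)
  also have "real (N choose n) * \<dots> \<le> real (N choose n) * exp (?z * (real n / real N)) ^ n"
    using z by (intro mult_left_mono power_mono exp_ge_add_one_self add_nonneg_nonneg mult_nonneg_nonneg) auto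
  also have "exp (?z * (real n / real N)) ^ n = exp (real n ^ 2 / real N * ?z)"
    by (simp add: exp_of_nat_mult[symmetric] power2_eq_square mult_ac)
  finally show ?thesis .
qed

text \<open>Exponential Markov inequality with an extra tilt \<open>b\<close>. The case
  \<open>a = 0\<close> bounds the number of sets with large overlap.\<close>

lemma overlap_tail:
  fixes a b t :: real
  assumes S0: "S0 \<in> subsets_of_size N n" and F: "F \<subseteq> subsets_of_size N n"
    and t: "\<And>S. S \<in> F \<Longrightarrow> t \<le> card (S0 \<inter> S)" and ab: "0 \<le> a" "0 \<le> b"
  shows "(\<Sum>S\<in>F. exp (a * card (S0 \<inter> S)))
     \<le> real (N choose n) * exp (real n ^ 2 / real N * (exp (a + b) - 1) - b * t)"
proof -
  have "(\<Sum>S\<in>F. exp (a * card (S0 \<inter> S))) \<le> (\<Sum>S\<in>F. exp ((a + b) * card (S0 \<inter> S)) * exp (- b * t))"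
  proof (rule sum_mono)
    fix S assume "S \<in> F"
    then have "b * t \<le> b * card (S0 \<inter> S)" using t ab by (intro mult_left_mono) auto
    then show "exp (a * card (S0 \<inter> S)) \<le> exp ((a + b) * card (S0 \<inter> S)) * exp (- b * t)"
      by (simp add: exp_add[symmetric] algebra_simps)
  qed
  also have "\<dots> = (\<Sum>S\<in>F. exp ((a + b) * card (S0 \<inter> S))) * exp (- b * t)"
    by (simp add: sum_distrib_right)
  also have "\<dots> \<le> (\<Sum>S\<in>subsets_of_size N n. exp ((a + b) * card (S0 \<inter> S))) * exp (- b * t)"
    by (intro mult_right_mono sum_mono2) (use F finite_subsets_of_size in auto)
  also have "\<dots> \<le> (real (N choose n) * exp (real n ^ 2 / real N * (exp (a + b) - 1))) * exp (- b * t)"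
    by (intro mult_right_mono overlap_mgf S0) (use ab in auto)
  finally show ?thesis by (simp add: mult.assoc exp_add[symmetric])
qed

section \<open>Small overlaps\<close>

text \<open>The centring is at least \<open>\<mu> (\<mu> - 1) / 2\<close>, the pair count at the
  mean overlap \<open>\<mu>\<close>. After this replacement the difference factorises and its sign
  can be read off from \<open>k - \<mu>\<close>.\<close>

lemma num_pairs_excess_le:
  fixes k n N :: nat
  assumes "N \<ge> 2"
  defines "\<mu> \<equiv> real n ^ 2 / real N"
  shows "2 * (num_pairs k - num_pairs n ^ 2 / num_pairs N) \<le> (real k - \<mu>) * (real k + \<mu> - 1)"
proof -
  have N: "real N \<ge> 2" using assms by simp
  have "\<mu>\<^sup>2 - \<mu> \<le> 2 * (num_pairs n ^ 2 / num_pairs N)"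
  proof -
    have "2 * (num_pairs n ^ 2 / num_pairs N) - (\<mu>\<^sup>2 - \<mu>)
       = real n ^ 2 * (real N - real n)\<^sup>2 / (real N ^ 2 * (real N - 1))"
      using N unfolding num_pairs_def \<mu>_def
      by (simp add: divide_simps) (simp add: power2_eq_square power4_eq_xxxx algebra_simps)
    moreover have "\<dots> \<ge> 0" using N by simp
    ultimately show ?thesis by linarith
  qed
  moreover have "2 * num_pairs k = (real k)\<^sup>2 - real k"
    by (simp add: num_pairs_def power2_eq_square right_diff_distrib)
  moreover have "(real k - \<mu>) * (real k + \<mu> - 1) = (real k)\<^sup>2 - real k - (\<mu>\<^sup>2 - \<mu>)"
    by (simp add: power2_eq_square algebra_simps)
  ultimately show ?thesis by (simp add: right_diff_distrib)
qed

lemma num_pairs_le: "num_pairs k \<le> real k ^ 2 / 2"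
  by (simp add: num_pairs_def power2_eq_square field_simps)

lemma num_pairs_nonneg: "0 \<le> num_pairs k"
  by (cases k) (auto simp: num_pairs_def)

text \<open>The three terms come from three ranges: \<open>A\<close>, where the exponent is at most
  \<open>c\<close>; \<open>B\<close>, overlaps up to twice the mean, governed by the total degree
  condition through \<open>\<tau>\<close>; and \<open>D\<close>, overlaps beyond twice the mean,
  where \<open>\<gamma> k / 2 \<le> \<kappa>\<close> makes the exponent linear in the
  overlap.\<close>

lemma small_overlap_sum:
  fixes \<gamma> c \<kappa> \<tau> t :: real
  assumes S0: "S0 \<in> subsets_of_size N n" and N: "N \<ge> 2" and n: "n > 0" and \<gamma>: "\<gamma> \<ge> 0" and c: "c > 0"
  defines "\<mu> \<equiv> real n ^ 2 / real N"
  assumes \<tau>: "3 / 2 * \<gamma> * \<mu> * sqrt \<mu> \<le> \<tau>" "0 < \<tau>" "\<tau> \<le> 1 / 2"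
    and \<kappa>: "\<gamma> * t / 2 \<le> \<kappa>" "0 < \<kappa>" "\<kappa> \<le> 1 / 20"
  shows "(\<Sum>S\<in>{S\<in>subsets_of_size N n. real (card (S0 \<inter> S)) \<le> t}.
            exp (\<gamma> * (num_pairs (card (S0 \<inter> S)) - num_pairs n ^ 2 / num_pairs N)))
     \<le> real (N choose n) * (exp c + exp (1 - c / (2 * \<tau>)) + exp (- c / (20 * \<kappa>)))"
proof -
  let ?K = "\<lambda>S. real (card (S0 \<inter> S))"
  let ?\<S> = "subsets_of_size N n"
  define f where "f S = \<gamma> * (num_pairs (card (S0 \<inter> S)) - num_pairs n ^ 2 / num_pairs N)" for S
  define A where "A = {S\<in>?\<S>. f S \<le> c}"
  define B where "B = {S\<in>?\<S>. c < f S \<and> ?K S \<le> 2 * \<mu>}"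
  define D where "D = {S\<in>?\<S>. c < f S \<and> 2 * \<mu> < ?K S \<and> ?K S \<le> t}"
  have fin: "finite A" "finite B" "finite D"
    unfolding A_def B_def D_def using finite_subsets_of_size by auto
  have \<mu>: "\<mu> > 0" unfolding \<mu>_def using n N by simp
  have fle: "f S \<le> \<gamma> / 2 * ((?K S - \<mu>) * (?K S + \<mu> - 1))" for S
    using mult_left_mono[OF num_pairs_excess_le[OF N, of "card (S0 \<inter> S)" n], of "\<gamma> / 2"] \<gamma>
    unfolding f_def \<mu>_def mult.assoc[symmetric] by simp
  have np: "num_pairs n ^ 2 / num_pairs N \<ge> 0"
    using num_pairs_nonneg by (intro divide_nonneg_nonneg) auto
  have sumA: "(\<Sum>S\<in>A. exp (f S)) \<le> real (N choose n) * exp c"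
  proof -
    have "(\<Sum>S\<in>A. exp (f S)) \<le> (\<Sum>S\<in>A. exp c)" by (rule sum_mono) (simp add: A_def)
    also have "\<dots> = real (card A) * exp c" by simp
    also have "\<dots> \<le> real (card ?\<S>) * exp c"
      by (intro mult_right_mono) (auto simp: A_def intro!: card_mono finite_subsets_of_size)
    finally show ?thesis by (simp add: card_subsets_of_size)
  qed
  have sumB: "(\<Sum>S\<in>B. exp (f S)) \<le> real (N choose n) * exp (1 - c / (2 * \<tau>))"
  proof (cases "B = {}")
    case False
    \<comment> \<open>The overlap fluctuates on the scale \<open>sqrt \<mu>\<close>, so an exponent
      of slope \<open>a\<close> in the deviation is of order \<open>\<tau>\<close>. The tilt
      \<open>b\<close> gains \<open>b * c / a = c / (2 * \<tau>)\<close> and the quadratic cost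
      \<open>\<mu> * (a + b)\<^sup>2\<close> stays at most \<open>1\<close>.\<close>
    define a where "a = \<tau> / sqrt \<mu>"
    define b where "b = 1 / (2 * sqrt \<mu>)"
    have sq: "sqrt \<mu> > 0" "sqrt \<mu> * sqrt \<mu> = \<mu>" using \<mu> by auto
    have a: "a > 0" "3 / 2 * \<gamma> * \<mu> \<le> a" and b: "b > 0"
      using \<tau> sq by (auto simp: a_def b_def pos_le_divide_eq)
    have B: "1 \<le> \<mu> \<and> f S \<le> a * (?K S - \<mu>)" if S: "S \<in> B" for S
    proof -
      have K: "c < f S" "?K S \<le> 2 * \<mu>" using S by (auto simp: B_def)
      \<comment> \<open>A positive exponent needs at least two common nodes. With
        \<open>?K S \<le> 2 * \<mu>\<close> this forces \<open>1 \<le> \<mu>\<close>, which later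
        gives \<open>a + b \<le> 1\<close>; it also makes \<open>?K S + \<mu> - 1\<close> positive,
        so that the overlap exceeds \<open>\<mu>\<close>.\<close>
      have "num_pairs (card (S0 \<inter> S)) > 0"
      proof (rule ccontr)
        assume "\<not> num_pairs (card (S0 \<inter> S)) > 0"
        then have "f S \<le> 0" using np \<gamma> unfolding f_def by (intro mult_nonneg_nonpos) auto
        then show False using K c by simp
      qed
      then have K2: "?K S \<ge> 2"
        by (cases "card (S0 \<inter> S)"; cases "card (S0 \<inter> S) - 1") (auto simp: num_pairs_def)
      have "0 < (\<gamma> / 2) * ((?K S - \<mu>) * (?K S + \<mu> - 1))" using K c fle[of S] by linarith
      then have "0 < (?K S - \<mu>) * (?K S + \<mu> - 1)"
        using \<gamma> by (simp add: zero_less_mult_iff)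
      then have pos: "0 < ?K S - \<mu>" using K2 \<mu> by (simp add: zero_less_mult_iff)
      have "f S \<le> \<gamma> / 2 * ((?K S - \<mu>) * (?K S + \<mu> - 1))" by (rule fle)
      also have "\<dots> \<le> \<gamma> / 2 * ((?K S - \<mu>) * (3 * \<mu>))"
        using \<gamma> pos K by (intro mult_left_mono) auto
      also have "\<dots> = 3 / 2 * \<gamma> * \<mu> * (?K S - \<mu>)" by simp
      also have "\<dots> \<le> a * (?K S - \<mu>)" using a pos by (intro mult_right_mono) auto
      finally show ?thesis using K2 K by auto
    qed
    have \<mu>1: "1 \<le> \<mu>" using B False by blast
    then have sq1: "1 \<le> sqrt \<mu>" by simp
    have "(\<Sum>S\<in>B. exp (f S)) \<le> (\<Sum>S\<in>B. exp (- a * \<mu>) * exp (a * ?K S))"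
      by (rule sum_mono) (use B in \<open>simp add: exp_add[symmetric] right_diff_distrib\<close>)
    also have "\<dots> = exp (- a * \<mu>) * (\<Sum>S\<in>B. exp (a * ?K S))" by (simp add: sum_distrib_left)
    also have "\<dots> \<le> exp (- a * \<mu>) * (real (N choose n) * exp (\<mu> * (exp (a + b) - 1) - b * (\<mu> + c / a)))"
      unfolding \<mu>_def
    proof (intro mult_left_mono overlap_tail[OF S0])
      fix S assume S: "S \<in> B"
      then have "c < a * (?K S - \<mu>)" using B[OF S] by (auto simp: B_def)
      then have "c / a < ?K S - \<mu>" using a by (simp add: pos_divide_less_eq mult.commute)
      then show "real n ^ 2 / real N + c / a \<le> ?K S" by (simp add: \<mu>_def)
    qed (use a b in \<open>auto simp: B_def\<close>)
    also have "\<dots> = real (N choose n) * exp (\<mu> * (exp (a + b) - 1) - b * (\<mu> + c / a) - a * \<mu>)"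
      unfolding mult.left_commute[of "exp (- a * \<mu>)"] exp_add[symmetric] by (simp add: algebra_simps)
    also have "\<dots> \<le> real (N choose n) * exp (1 - c / (2 * \<tau>))"
    proof (intro mult_left_mono)
      have ab: "a + b = (\<tau> + 1 / 2) / sqrt \<mu>" by (simp add: a_def b_def add_divide_distrib)
      have "a + b \<le> 1" unfolding ab using \<tau>(3) sq(1) sq1 by (subst divide_le_eq_1_pos) linarith+
      then have "exp (a + b) - 1 \<le> (a + b) + (a + b)\<^sup>2" using a b exp_bound[of "a + b"] by simp
      then have "\<mu> * (exp (a + b) - 1) \<le> \<mu> * ((a + b) + (a + b)\<^sup>2)" using \<mu> by (intro mult_left_mono) auto
      moreover have "\<mu> * (a + b)\<^sup>2 = (\<tau> + 1 / 2)\<^sup>2"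
        using \<mu> unfolding ab by (simp add: power_divide)
      moreover have "(\<tau> + 1 / 2)\<^sup>2 \<le> 1\<^sup>2" using \<tau> by (intro power_mono) auto
      moreover have "b * (c / a) = c / (2 * \<tau>)" using sq \<tau> by (simp add: a_def b_def)
      ultimately show "exp (\<mu> * (exp (a + b) - 1) - b * (\<mu> + c / a) - a * \<mu>) \<le> exp (1 - c / (2 * \<tau>))"
        by (simp add: distrib_left distrib_right mult.commute)
    qed simp
    finally show ?thesis .
  qed simp
  have sumD: "(\<Sum>S\<in>D. exp (f S)) \<le> real (N choose n) * exp (- c / (20 * \<kappa>))"
  proof -
    \<comment> \<open>A convex combination of the lower bounds \<open>2 * \<mu>\<close> and
      \<open>c / \<kappa>\<close> on the overlap. With tilt \<open>1 / 4\<close> the first part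
      yields \<open>2 / 5 * \<mu>\<close>, just enough to pay for
      \<open>\<mu> * (exp (3 / 10) - 1)\<close>, and the second leaves
      \<open>c / (20 * \<kappa>)\<close>.\<close>
    have D: "f S \<le> \<kappa> * ?K S \<and> 4 / 5 * (2 * \<mu>) + 1 / 5 * (c / \<kappa>) \<le> ?K S" if S: "S \<in> D" for S
    proof -
      have K: "c < f S" "2 * \<mu> < ?K S" "?K S \<le> t" using S by (auto simp: D_def)
      have "f S \<le> \<gamma> * num_pairs (card (S0 \<inter> S))"
        unfolding f_def using \<gamma> np by (intro mult_left_mono) auto
      also have "\<dots> \<le> \<gamma> * (?K S ^ 2 / 2)" using \<gamma> num_pairs_le by (intro mult_left_mono) auto
      also have "\<dots> = (\<gamma> * ?K S / 2) * ?K S" by (simp add: power2_eq_square)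
      also have "\<dots> \<le> (\<gamma> * t / 2) * ?K S" using \<gamma> K by (intro mult_right_mono mult_left_mono divide_right_mono) auto
      also have "\<dots> \<le> \<kappa> * ?K S" using \<kappa> by (intro mult_right_mono) auto
      finally have 1: "f S \<le> \<kappa> * ?K S" .
      then have "c / \<kappa> \<le> ?K S" using K \<kappa> by (simp add: pos_divide_le_eq mult.commute)
      with 1 K show ?thesis by simp
    qed
    have "(\<Sum>S\<in>D. exp (f S)) \<le> (\<Sum>S\<in>D. exp (\<kappa> * ?K S))" by (rule sum_mono) (use D in simp)
    also have "\<dots> \<le> real (N choose n) * exp (real n ^ 2 / real N * (exp (\<kappa> + 1 / 4) - 1)
         - 1 / 4 * (4 / 5 * (2 * \<mu>) + 1 / 5 * (c / \<kappa>)))"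
      by (rule overlap_tail[OF S0]) (use D \<kappa> in \<open>auto simp: D_def\<close>)
    also have "\<dots> \<le> real (N choose n) * exp (- c / (20 * \<kappa>))"
    proof (intro mult_left_mono)
      have "exp (\<kappa> + 1 / 4) \<le> exp (3 / 10)" using \<kappa> by simp
      also have "\<dots> \<le> 1 + 3 / 10 + (3 / 10)\<^sup>2" by (rule exp_bound) auto
      finally have "\<mu> * (exp (\<kappa> + 1 / 4) - 1) \<le> \<mu> * (2 / 5)"
        using \<mu> by (intro mult_left_mono) (auto simp: power2_eq_square)
      then show "exp (real n ^ 2 / real N * (exp (\<kappa> + 1 / 4) - 1)
         - 1 / 4 * (4 / 5 * (2 * \<mu>) + 1 / 5 * (c / \<kappa>))) \<le> exp (- c / (20 * \<kappa>))"
        by (simp add: \<mu>_def[symmetric] add_divide_distrib)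
    qed simp
    finally show ?thesis .
  qed
  have "(\<Sum>S\<in>{S\<in>?\<S>. ?K S \<le> t}. exp (f S)) \<le> (\<Sum>S\<in>A \<union> B \<union> D. exp (f S))"
    by (rule sum_mono2) (use fin in \<open>auto simp: A_def B_def D_def\<close>)
  also have "\<dots> = (\<Sum>S\<in>A. exp (f S)) + (\<Sum>S\<in>B. exp (f S)) + (\<Sum>S\<in>D. exp (f S))"
    by (subst sum.union_disjoint sum.union_disjoint | use fin in \<open>force simp: A_def B_def D_def\<close>)+
  also have "\<dots> \<le> real (N choose n) * (exp c + exp (1 - c / (2 * \<tau>)) + exp (- c / (20 * \<kappa>)))"
    using sumA sumB sumD by (simp add: distrib_left)
  finally show ?thesis by (simp add: f_def)
qed

section \<open>Large overlaps\<close>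

text \<open>Here \<open>x = k / n\<close>, and gain and overlap probability are compared per common
  node. For \<open>x \<ge> 1 / 2\<close> the logarithm is bounded and the margin
  \<open>\<epsilon>\<close> of the entropy condition decides. For \<open>x < 1 / 2\<close> the gain
  uses about half of \<open>l\<close> and \<open>ln x\<close> at most a quarter, so a quarter of
  \<open>l\<close> is left.\<close>

lemma large_overlap_exponent:
  fixes l x \<epsilon> :: real
  assumes \<epsilon>: "0 < \<epsilon>" "\<epsilon> \<le> 1 / 2" and l: "l \<ge> 8 / \<epsilon>" and x: "exp (- l / 4) \<le> x" "x \<le> 1"
  shows "l * ((1 - \<epsilon>) * x + \<epsilon> / 8) - (l + ln x - 1) \<le> - (\<epsilon> * l / 8)"
proof -
  have x0: "x > 0" using x(1) exp_gt_zero[of "- l / 4"] by linarith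
  have l8: "\<epsilon> * l \<ge> 8" using l \<epsilon> by (simp add: pos_divide_le_eq mult.commute)
  have "\<epsilon> * l \<le> 1 / 2 * l" using \<epsilon> l8 zero_less_mult_pos[of \<epsilon> l] by (intro mult_right_mono) auto
  then have l16: "l \<ge> 16" using l8 by simp
  show ?thesis
  proof (cases "x \<ge> 1 / 2")
    case True
    have "ln (1 / 2) \<le> ln x" using True by (simp add: ln_le_cancel_iff)
    moreover have "ln (1 / 2 :: real) \<ge> - 1" using ln_le_minus_one[of 2] by (simp add: ln_div)
    moreover have "\<epsilon> * l * x \<ge> \<epsilon> * l * (1 / 2)" using True l8 by (intro mult_left_mono) auto
    moreover have "l * (1 - x) \<ge> 0" using x l16 by simp
    ultimately show ?thesis using l8 by (simp add: algebra_simps)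
  next
    case False
    have "ln (exp (- l / 4)) \<le> ln x" using x x0 by (subst ln_le_cancel_iff) auto
    moreover have "l * x \<le> l * (1 / 2)" using False l16 by (intro mult_left_mono) auto
    moreover have "\<epsilon> * l * x \<ge> 0" using l8 x0 by simp
    moreover have "\<epsilon> * l \<le> 1 / 2 * l" by fact
    moreover have "l * ((1 - \<epsilon>) * x + \<epsilon> / 8) = l * x - \<epsilon> * l * x + \<epsilon> * l / 8"
      by (simp add: algebra_simps)
    moreover have "ln (exp (- l / 4)) = - l / 4" by simp
    ultimately show ?thesis using l16 by linarith
  qed
qed

lemma sum_exp_power_le:
  fixes a :: real
  assumes "a \<ge> 1" shows "(\<Sum>k\<in>{1..n}. exp (- a) ^ k) \<le> 2 * exp (- a)"
proof -
  define r where "r = exp (- a)"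
  have "r \<le> exp (- 1)" using assms by (simp add: r_def)
  also have "exp (- 1 :: real) \<le> 1 / 2" using exp_ge_add_one_self[of 1] by (simp add: exp_minus field_simps)
  finally have r: "r \<le> 1 / 2" "0 < r" by (auto simp: r_def)
  have "(1 - r) * (\<Sum>k\<in>{1..n}. r ^ k) \<le> r"
    using sum_gp_multiplied[of 1 n r] r by (cases "n = 0") (auto simp: mult.commute)
  moreover have "(1 / 2) * (\<Sum>k\<in>{1..n}. r ^ k) \<le> (1 - r) * (\<Sum>k\<in>{1..n}. r ^ k)"
    using r by (intro mult_right_mono sum_nonneg) auto
  ultimately show ?thesis by (simp add: r_def)
qed

text \<open>For each exact overlap \<open>k\<close> the number of sets times the gain is at most
  \<open>r ^ k\<close> of the total with \<open>r = exp (- \<epsilon> * l / 8)\<close>, a geometric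
  series.\<close>

lemma large_overlap_sum:
  fixes \<epsilon> l :: real and g :: "nat \<Rightarrow> real"
  assumes S0: "S0 \<in> subsets_of_size N n" and n: "0 < n" "n < N"
  defines "l \<equiv> ln (real N / real n)"
  assumes \<epsilon>: "0 < \<epsilon>" "\<epsilon> \<le> 1 / 2" and l: "l \<ge> 8 / \<epsilon>"
    and g: "\<And>k. k \<le> n \<Longrightarrow> real n * exp (- l / 4) < real k \<Longrightarrow>
        g k \<le> exp (real k * (l * ((1 - \<epsilon>) * (real k / real n) + \<epsilon> / 8)))"
  shows "(\<Sum>S\<in>{S\<in>subsets_of_size N n. real n * exp (- l / 4) < real (card (S0 \<inter> S))}.
            g (card (S0 \<inter> S))) \<le> real (N choose n) * (2 * exp (- \<epsilon> * l / 8))"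
proof -
  let ?F = "{S\<in>subsets_of_size N n. real n * exp (- l / 4) < real (card (S0 \<inter> S))}"
  define r where "r = exp (- \<epsilon> * l / 8)"
  have l0: "l > 0" unfolding l_def using n by (simp add: ln_gt_zero)
  have S0': "finite S0" "card S0 = n" using S0 finite_subset by (auto simp: subsets_of_size_def)
  have exp_l: "exp l = real N / real n" unfolding l_def using n by simp
  have finF: "finite ?F" using finite_subsets_of_size by auto
  have img: "(\<lambda>S. card (S0 \<inter> S)) ` ?F \<subseteq> {1..n}"
  proof
    fix k assume "k \<in> (\<lambda>S. card (S0 \<inter> S)) ` ?F"
    then obtain S where S: "k = card (S0 \<inter> S)" "real n * exp (- l / 4) < real k" by auto
    have "k \<le> n" using card_mono[of S0 "S0 \<inter> S"] S0' S by simp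
    moreover have "0 < real k" using S(2) by (rule order.strict_trans1[rotated]) simp
    ultimately show "k \<in> {1..n}" by simp
  qed
  have "(\<Sum>S\<in>?F. g (card (S0 \<inter> S))) = (\<Sum>k\<in>{1..n}. \<Sum>S\<in>{S\<in>?F. card (S0 \<inter> S) = k}. g (card (S0 \<inter> S)))"
    by (rule sum.group[symmetric]) (use finF img in auto)
  also have "\<dots> \<le> (\<Sum>k\<in>{1..n}. real (N choose n) * r ^ k)"
  proof (rule sum_mono)
    fix k assume k: "k \<in> {1..n}"
    let ?Fk = "{S\<in>?F. card (S0 \<inter> S) = k}"
    show "(\<Sum>S\<in>?Fk. g (card (S0 \<inter> S))) \<le> real (N choose n) * r ^ k"
    proof (cases "real n * exp (- l / 4) < real k")
      case False
      then have "?Fk = {}" by auto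
      then show ?thesis by (simp only: sum.empty) (simp add: r_def)
    next
      case True
      define x where "x = real k / real n"
      have x: "exp (- l / 4) \<le> x" "x \<le> 1" "x > 0"
        using True k n by (auto simp: x_def pos_le_divide_eq mult.commute)
      \<comment> \<open>The optimal tilt: it makes \<open>n\<^sup>2 / N * exp s\<close> equal to
        \<open>k\<close>, that is, it moves the mean overlap to \<open>k\<close>.\<close>
      define s where "s = l + ln x"
      have "ln (exp (- l / 4)) \<le> ln x" using x by (subst ln_le_cancel_iff) auto
      then have s: "s \<ge> 0" using l0 by (simp add: s_def)
      have "(\<Sum>S\<in>?Fk. g (card (S0 \<inter> S))) = real (card ?Fk) * g k" by simp
      also have "\<dots> \<le> real (card ?Fk) * exp (real k * (l * ((1 - \<epsilon>) * x + \<epsilon> / 8)))"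
        using g True k by (intro mult_left_mono) (auto simp: x_def)
      also have "real (card ?Fk) = (\<Sum>S\<in>?Fk. exp (0 * real (card (S0 \<inter> S))))" by simp
      also have "\<dots> \<le> real (N choose n) * exp (real n ^ 2 / real N * (exp (0 + s) - 1) - s * k)"
        by (rule overlap_tail[OF S0]) (use s in auto)
      also have "\<dots> \<le> real (N choose n) * exp (- real k * (l + ln x - 1))"
      proof (intro mult_left_mono)
        have "real n ^ 2 / real N * exp s = real k"
          using x n unfolding s_def exp_add exp_l by (simp add: x_def power2_eq_square)
        moreover have "0 \<le> real n ^ 2 / real N" by simp
        ultimately have "real n ^ 2 / real N * (exp s - 1) \<le> real k" by (simp add: right_diff_distrib)
        then show "exp (real n ^ 2 / real N * (exp (0 + s) - 1) - s * k) \<le> exp (- real k * (l + ln x - 1))"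
          by (simp add: s_def algebra_simps)
      qed simp
      also have "real (N choose n) * exp (- real k * (l + ln x - 1)) * exp (real k * (l * ((1 - \<epsilon>) * x + \<epsilon> / 8)))
         = real (N choose n) * exp (real k * (l * ((1 - \<epsilon>) * x + \<epsilon> / 8) - (l + ln x - 1)))"
        unfolding mult.assoc exp_add[symmetric] by (simp add: algebra_simps)
      also have "\<dots> \<le> real (N choose n) * exp (real k * (- (\<epsilon> * l / 8)))"
        using mult_left_mono[OF large_overlap_exponent[OF \<epsilon> l x(1,2)], of "real k"] by (intro mult_left_mono) auto
      also have "exp (real k * (- (\<epsilon> * l / 8))) = r ^ k"
        by (simp add: r_def exp_of_nat_mult[symmetric])
      finally show ?thesis by (simp add: mult_right_mono)
    qed
  qed
  also have "\<dots> = real (N choose n) * (\<Sum>k\<in>{1..n}. r ^ k)" by (simp add: sum_distrib_left)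
  also have "\<dots> \<le> real (N choose n) * (2 * r)"
  proof (intro mult_left_mono)
    have "8 \<le> \<epsilon> * l" using l \<epsilon> by (simp add: pos_divide_le_eq mult.commute)
    then show "(\<Sum>k\<in>{1..n}. r ^ k) \<le> 2 * r"
      using sum_exp_power_le[of "\<epsilon> * l / 8" n] by (simp add: r_def)
  qed simp
  finally show ?thesis by (simp add: r_def)
qed

section \<open>Truncation of dense subgraphs\<close>

text \<open>The bound \<open>(e n / k) ^ k\<close>, obtained by keeping one term of the expansion of
  \<open>(1 + k / n) ^ n \<le> exp k\<close>.\<close>

lemma binomial_le_exp:
  assumes "1 \<le> k" "k \<le> n"
  shows "real (n choose k) \<le> exp (real k * (1 + ln (real n / real k)))"
proof -
  define x where "x = real k / real n"
  have x: "x > 0" using assms by (simp add: x_def)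
  have "real (n choose k) * x ^ k \<le> (\<Sum>j\<le>n. real (n choose j) * x ^ j * 1 ^ (n - j))"
    using member_le_sum[of k "{..n}" "\<lambda>j. real (n choose j) * x ^ j"] assms x by simp
  also have "\<dots> = (x + 1) ^ n" by (simp add: binomial_ring)
  also have "\<dots> \<le> exp x ^ n"
    using x exp_ge_add_one_self[of x] by (intro power_mono) (auto simp: add.commute)
  also have "\<dots> = exp (real k)" using assms by (simp add: exp_of_nat_mult[symmetric] x_def)
  finally have "real (n choose k) \<le> exp (real k) / x ^ k" using x by (simp add: pos_le_divide_eq)
  also have "\<dots> = exp (real k) * exp (ln (1 / x)) ^ k" using x by (simp add: power_divide)
  also have "\<dots> = exp (real k * (1 + ln (real n / real k)))"
    by (simp add: x_def exp_of_nat_mult[symmetric] exp_add[symmetric] distrib_left)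
  finally show ?thesis .
qed

text \<open>The truncation event of a single \<open>S\<close>. It is imposed on all large
  \<open>T \<subseteq> S\<close> because the intersection with a second, unknown node set may be any
  of them.\<close>

definition sparse_subgraphs :: "real \<Rightarrow> (nat \<Rightarrow> real) \<Rightarrow> nat set \<Rightarrow> (nat \<times> nat) set \<Rightarrow> bool" where
  "sparse_subgraphs t w S X \<longleftrightarrow>
     (\<forall>T\<subseteq>S. t < real (card T) \<longrightarrow> real (card (X \<inter> inner_pairs T)) \<le> w (card T))"

text \<open>Union bound over the subsets \<open>T\<close>. In the required exponent
  \<open>1 + ln (n / k)\<close> cancels the number of \<open>k\<close>-subsets and \<open>M\<close>
  leaves a geometric series.\<close>

lemma not_sparse_weight_le:
  fixes M q t :: real
  assumes S: "S \<subseteq> {1..N}" "card S = n" and pq: "0 \<le> p" "p \<le> 1" "0 \<le> q" "q \<le> 1"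
    and t: "t \<ge> 0" and M: "M \<ge> 1"
    and tail: "\<And>k. k \<le> n \<Longrightarrow> t < real k \<Longrightarrow> \<exists>s\<ge>0. - s * w k + q * num_pairs k * (exp s - 1)
              \<le> - (real k * (1 + ln (real n / real k) + M))"
  shows "(\<Sum>X\<in>{X\<in>Pow (node_pairs N). \<not> sparse_subgraphs t w S X}.
            config_weight (node_pairs N) (planted_prob p q (inner_pairs S)) X) \<le> 2 * exp (- M)"
proof -
  let ?A = "node_pairs N"
  let ?wt = "config_weight ?A (planted_prob p q (inner_pairs S))"
  define \<T> where "\<T> = {T. T \<subseteq> S \<and> t < real (card T)}"
  have finS: "finite S" using S finite_subset by blast
  have fin\<T>: "finite \<T>" unfolding \<T>_def using finS by auto
  have SA: "inner_pairs S \<subseteq> ?A" using S by (auto simp: node_pairs_eq_inner_pairs inner_pairs_def)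
  have wt: "?wt X \<ge> 0" for X by (rule config_weight_nonneg) (use pq in \<open>auto simp: planted_prob_def\<close>)
  let ?bad = "\<lambda>T X. w (card T) < real (card (X \<inter> inner_pairs T))"
  have "(\<Sum>X\<in>{X\<in>Pow ?A. \<not> sparse_subgraphs t w S X}. ?wt X)
     \<le> (\<Sum>X\<in>{X\<in>Pow ?A. \<not> sparse_subgraphs t w S X}. \<Sum>T\<in>\<T>. of_bool (?bad T X) * ?wt X)"
  proof (rule sum_mono)
    fix X assume "X \<in> {X\<in>Pow ?A. \<not> sparse_subgraphs t w S X}"
    then obtain T where T: "T \<in> \<T>" "?bad T X"
      by (auto simp: sparse_subgraphs_def \<T>_def not_le)
    show "?wt X \<le> (\<Sum>T\<in>\<T>. of_bool (?bad T X) * ?wt X)"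
      using member_le_sum[OF T(1), of "\<lambda>T. of_bool (?bad T X) * ?wt X"] T wt fin\<T> by simp
  qed
  also have "\<dots> \<le> (\<Sum>X\<in>Pow ?A. \<Sum>T\<in>\<T>. of_bool (?bad T X) * ?wt X)"
    by (rule sum_mono2) (use finite_node_pairs wt in \<open>auto intro!: sum_nonneg\<close>)
  also have "\<dots> = (\<Sum>T\<in>\<T>. \<Sum>X\<in>Pow ?A. of_bool (?bad T X) * ?wt X)" by (rule sum.swap)
  also have "\<dots> = (\<Sum>T\<in>\<T>. \<Sum>X\<in>{X\<in>Pow ?A. ?bad T X}. ?wt X)"
  proof (rule sum.cong[OF refl])
    fix T
    show "(\<Sum>X\<in>Pow ?A. of_bool (?bad T X) * ?wt X) = (\<Sum>X\<in>{X\<in>Pow ?A. ?bad T X}. ?wt X)"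
      by (rule sum.mono_neutral_cong_right) (use finite_node_pairs in auto)
  qed
  also have "\<dots> \<le> (\<Sum>T\<in>\<T>. exp (- (real (card T) * (1 + ln (real n / real (card T)) + M))))"
  proof (rule sum_mono)
    fix T assume T: "T \<in> \<T>"
    then have TS: "T \<subseteq> S" "t < real (card T)" "finite T" using finS finite_subset by (auto simp: \<T>_def)
    have "card T \<le> n" using card_mono[OF finS TS(1)] S by simp
    then obtain s where s: "s \<ge> 0" "- s * w (card T) + q * num_pairs (card T) * (exp s - 1)
              \<le> - (real (card T) * (1 + ln (real n / real (card T)) + M))"
      using tail TS by blast
    have "(\<Sum>X\<in>{X\<in>Pow ?A. ?bad T X}. ?wt X)
       \<le> exp (- s * w (card T) + q * card (inner_pairs T) * (exp s - 1))"
      by (rule chernoff_planted) (use finite_node_pairs inner_pairs_mono TS SA pq s in auto)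
    also have "\<dots> \<le> exp (- (real (card T) * (1 + ln (real n / real (card T)) + M)))"
      using s TS by (simp add: card_inner_pairs)
    finally show "(\<Sum>X\<in>{X\<in>Pow ?A. ?bad T X}. ?wt X) \<le> \<dots>" .
  qed
  also have "\<dots> = (\<Sum>k\<in>{1..n}. \<Sum>T\<in>{T\<in>\<T>. card T = k}.
      exp (- (real (card T) * (1 + ln (real n / real (card T)) + M))))"
  proof (rule sum.group[symmetric])
    show "card ` \<T> \<subseteq> {1..n}"
    proof
      fix k assume "k \<in> card ` \<T>"
      then obtain T where T: "T \<subseteq> S" "t < real (card T)" "k = card T" by (auto simp: \<T>_def)
      then have "0 < real k" using t by linarith
      then show "k \<in> {1..n}" using T card_mono[OF finS T(1)] S by simp
    qed
  qed (use fin\<T> in auto)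
  also have "\<dots> \<le> (\<Sum>k\<in>{1..n}. exp (- M) ^ k)"
  proof (rule sum_mono)
    fix k assume k: "k \<in> {1..n}"
    have "(\<Sum>T\<in>{T\<in>\<T>. card T = k}. exp (- (real (card T) * (1 + ln (real n / real (card T)) + M))))
       = real (card {T\<in>\<T>. card T = k}) * exp (- (real k * (1 + ln (real n / real k) + M)))"
      by simp
    also have "\<dots> \<le> real (n choose k) * exp (- (real k * (1 + ln (real n / real k) + M)))"
    proof (intro mult_right_mono)
      have "card {T\<in>\<T>. card T = k} \<le> card {T. T \<subseteq> S \<and> card T = k}"
        by (rule card_mono) (use finS in \<open>auto simp: \<T>_def\<close>)
      then show "real (card {T\<in>\<T>. card T = k}) \<le> real (n choose k)"
        using n_subsets[OF finS, of k] S by simp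
    qed simp
    also have "\<dots> \<le> exp (real k * (1 + ln (real n / real k))) * exp (- (real k * (1 + ln (real n / real k) + M)))"
      by (intro mult_right_mono binomial_le_exp) (use k in auto)
    also have "\<dots> = exp (- M) ^ k"
      by (simp add: exp_add[symmetric] exp_of_nat_mult[symmetric] algebra_simps)
    finally show "(\<Sum>T\<in>{T\<in>\<T>. card T = k}. exp (- (real (card T) * (1 + ln (real n / real (card T)) + M))))
        \<le> exp (- M) ^ k" .
  qed
  also have "\<dots> \<le> 2 * exp (- M)" by (rule sum_exp_power_le[OF M])
  finally show ?thesis .
qed

text \<open>Two Chernoff regimes with \<open>x = k / n\<close>. If \<open>y \<le> q n x\<close>, the
  Gaussian exponent \<open>y\<^sup>2 / (2 q n x) \<ge> (1 + M) / x\<close> suffices because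
  \<open>ln (1 / x) \<le> 1 / x - 1\<close>. Otherwise \<open>s = 1\<close> leaves at least
  \<open>y / 2 \<ge> l / 2\<close>.\<close>

lemma tail_exponent_dense:
  fixes q y l M :: real
  assumes k: "1 \<le> k" "k \<le> n" and q: "q \<ge> 0" and l: "ln (real n / real k) \<le> l / 4" "1 + M \<le> l / 4"
    and M: "M \<ge> 0" and y: "y \<ge> l" "y\<^sup>2 \<ge> 2 * (1 + M) * (q * real n)"
  shows "\<exists>s\<ge>0. - s * (q * num_pairs k + y * real k) + q * num_pairs k * (exp s - 1)
              \<le> - (real k * (1 + ln (real n / real k) + M))"
proof -
  define x where "x = real k / real n"
  have x: "0 < x" "x \<le> 1" using k by (auto simp: x_def)
  have y0: "y > 0" using l M y by linarith
  have k2: "q * num_pairs k \<le> real k * (q * real n * x / 2)"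
    using mult_left_mono[OF num_pairs_le q, of k] k by (simp add: x_def power2_eq_square mult_ac)
  have exponent: "- s * (q * num_pairs k + y * real k) + q * num_pairs k * (exp s - 1)
      \<le> - (real k * (s * y - q * real n * x / 2 * s\<^sup>2))" if s: "0 \<le> s" "s \<le> 1" for s
  proof -
    have "exp s - 1 - s \<le> s\<^sup>2" using exp_bound[OF s] by simp
    then have "q * num_pairs k * (exp s - 1 - s) \<le> q * num_pairs k * s\<^sup>2"
      using q num_pairs_nonneg by (intro mult_left_mono) auto
    also have "\<dots> \<le> real k * (q * real n * x / 2) * s\<^sup>2" by (intro mult_right_mono k2) auto
    finally show ?thesis by (simp add: algebra_simps)
  qed
  have L: "ln (real n / real k) \<le> 1 / x - 1"
    using ln_le_minus_one[of "real n / real k"] k by (simp add: x_def)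
  show ?thesis
  proof (cases "y \<le> q * real n * x")
    case True
    \<comment> \<open>The optimum of the quadratic bound in \<open>exponent\<close>; the case
      assumption puts it into \<open>s \<le> 1\<close>, where that bound holds.\<close>
    define s where "s = y / (q * real n * x)"
    have pos: "0 < q * real n * x" using True y0 by linarith
    have s: "0 \<le> s" "s \<le> 1" using True y0 pos by (auto simp: s_def)
    have "s * y - q * real n * x / 2 * s\<^sup>2 = y\<^sup>2 / (2 * (q * real n * x))"
      using pos by (simp add: s_def power2_eq_square field_simps)
    also have "\<dots> \<ge> 2 * (1 + M) * (q * real n) / (2 * (q * real n * x))"
      using y(2) pos by (intro divide_right_mono) auto
    also have "2 * (1 + M) * (q * real n) / (2 * (q * real n * x)) = (1 + M) / x"
    proof -
      have "2 * (1 + M) * z / (2 * (z * x)) = (1 + M) / x" if "z \<noteq> 0" for z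
        using that x by (simp add: field_simps)
      then show ?thesis using pos by auto
    qed
    finally have "(1 + M) / x \<le> s * y - q * real n * x / 2 * s\<^sup>2" .
    moreover have "1 + ln (real n / real k) + M \<le> (1 + M) / x"
    proof -
      have "M * 1 \<le> M * (1 / x)" using M x by (intro mult_left_mono) auto
      then show ?thesis using L by (simp add: add_divide_distrib)
    qed
    ultimately have "real k * (1 + ln (real n / real k) + M) \<le> real k * (s * y - q * real n * x / 2 * s\<^sup>2)"
      by (intro mult_left_mono) auto
    then show ?thesis using exponent[OF s] s by (intro exI[of _ s]) linarith
  next
    case False
    have "1 + ln (real n / real k) + M \<le> 1 * y - q * real n * x / 2 * 1\<^sup>2"
      using False y l by simp
    then have "real k * (1 + ln (real n / real k) + M) \<le> real k * (1 * y - q * real n * x / 2 * 1\<^sup>2)"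
      by (intro mult_left_mono) auto
    then show ?thesis using exponent[of 1] by (intro exI[of _ 1]) linarith
  qed
qed

text \<open>The slack per node is comparable with \<open>q n\<close>, so a large deviation estimate
  is available for all \<open>k\<close>: a constant tilt if \<open>ln (n / k)\<close> is bounded,
  and the tilt \<open>ln (n / k)\<close> for smaller subsets.\<close>

lemma tail_exponent_sparse:
  fixes q y A M :: real
  assumes k: "1 \<le> k" "k \<le> n" and q: "q \<ge> 0" and A: "A \<ge> 0" "q * real n \<le> A * y" and M: "M \<ge> 0"
    and y: "y \<ge> 2 * (1 + A) * (2 + A + M)"
  shows "\<exists>s\<ge>0. - s * (q * num_pairs k + y * real k) + q * num_pairs k * (exp s - 1)
              \<le> - (real k * (1 + ln (real n / real k) + M))"
proof -
  let ?L = "ln (real n / real k)"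
  have "2 * 1 * (2 + M) \<le> 2 * (1 + A) * (2 + A + M)" using A M by (intro mult_mono) auto
  then have y2: "y \<ge> 4 + 2 * M" using y by simp
  have k2: "q * num_pairs k \<le> q * real k ^ 2 / 2" using mult_left_mono[OF num_pairs_le q, of k] by simp
  show ?thesis
  proof (cases "?L \<le> A + 1")
    case True
    \<comment> \<open>With \<open>A * s \<le> 1\<close> the second order term is at most half of the
      linear gain \<open>s * y * k\<close>.\<close>
    define s where "s = 1 / (1 + A)"
    have s: "0 < s" "s \<le> 1" "A * s \<le> 1" using A by (auto simp: s_def)
    have "q * num_pairs k \<le> q * real k ^ 2 / 2" by (rule k2)
    also have "\<dots> \<le> q * (real k * real n) / 2"
      using q k by (intro divide_right_mono mult_left_mono) (auto simp: power2_eq_square)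
    also have "\<dots> \<le> real k * (A * y) / 2" using mult_left_mono[OF A(2), of "real k"] by (simp add: mult_ac)
    finally have k3: "q * num_pairs k \<le> real k * (A * y) / 2" .
    have "exp s - 1 - s \<le> s\<^sup>2" using exp_bound[of s] s by simp
    then have "q * num_pairs k * (exp s - 1 - s) \<le> q * num_pairs k * s\<^sup>2"
      using q num_pairs_nonneg by (intro mult_left_mono) auto
    also have "\<dots> \<le> real k * (A * y) / 2 * s\<^sup>2" by (intro mult_right_mono k3) auto
    also have "\<dots> = (A * s) * (real k * y * s / 2)" by (simp add: power2_eq_square)
    also have "\<dots> \<le> 1 * (real k * y * s / 2)" using s y2 M by (intro mult_right_mono) auto
    finally have "- s * (q * num_pairs k + y * real k) + q * num_pairs k * (exp s - 1) \<le> - (real k * (y * s / 2))"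
      by (simp add: algebra_simps)
    also have "y * s / 2 \<ge> 2 + A + M"
      using y A by (simp add: s_def pos_le_divide_eq mult_ac)
    then have "- (real k * (y * s / 2)) \<le> - (real k * (1 + ?L + M))"
      using True by (intro le_imp_neg_le mult_left_mono) auto
    finally show ?thesis using s by (intro exI[of _ s]) auto
  next
    case False
    \<comment> \<open>For \<open>s = ?L\<close> the factor \<open>exp s\<close> is
      \<open>n / k\<close>, so the tilted mean is at most \<open>k q n / 2\<close>, which by
      \<open>q n \<le> A y\<close> and \<open>A \<le> ?L\<close> uses at most half of the
      gain.\<close>
    have L: "?L \<ge> 1" "A \<le> ?L" using False A by auto
    have "q * num_pairs k * (exp ?L - 1) \<le> q * num_pairs k * exp ?L"
      using q num_pairs_nonneg by (intro mult_left_mono) auto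
    also have "\<dots> \<le> (q * real k ^ 2 / 2) * exp ?L" by (intro mult_right_mono k2) auto
    also have "\<dots> = real k * (q * real n / 2)" using k by (simp add: power2_eq_square)
    also have "\<dots> \<le> real k * (A * y / 2)" using A by (intro mult_left_mono) auto
    also have "\<dots> \<le> real k * (?L * y / 2)" using L y2 M by (intro mult_left_mono divide_right_mono mult_right_mono) auto
    finally have 1: "q * num_pairs k * (exp ?L - 1) \<le> real k * (?L * y / 2)" .
    have "1 * (y / 2 - 1) \<le> ?L * (y / 2 - 1)" using L y2 M by (intro mult_right_mono) auto
    then have "1 + ?L + M \<le> ?L * y / 2" using y2 by (simp add: right_diff_distrib)
    then have "real k * (1 + ?L + M) \<le> real k * (?L * y / 2)" by (intro mult_left_mono) auto
    moreover have "0 \<le> ?L * (q * num_pairs k)" using L q num_pairs_nonneg by (intro mult_nonneg_nonneg) auto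
    ultimately have "- ?L * (q * num_pairs k + y * real k) + q * num_pairs k * (exp ?L - 1)
        \<le> - (real k * (1 + ?L + M))"
      using 1 by (simp add: algebra_simps)
    then show ?thesis using L by (intro exI[of _ ?L]) auto
  qed
qed

section \<open>Entropy bounds\<close>

lemma bernoulli_entropy_has_derivative:
  assumes "0 < t" "t < 1" "0 < q" "q < 1"
  shows "((\<lambda>t. bernoulli_entropy t q) has_real_derivative - (q - t) / (t * (1 - t))) (at t)"
proof (rule has_field_derivative_transform_within_open)
  have "((\<lambda>t. q * (ln q - ln t) + (1 - q) * (ln (1 - q) - ln (1 - t)))
      has_real_derivative (1 - q) / (1 - t) - q / t) (at t)"
    using assms by (auto intro!: derivative_eq_intros simp: divide_inverse)
  also have "(1 - q) / (1 - t) - q / t = - (q - t) / (t * (1 - t))"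
    using assms by (simp add: divide_simps) (simp add: algebra_simps)
  finally show "((\<lambda>t. q * (ln q - ln t) + (1 - q) * (ln (1 - q) - ln (1 - t)))
      has_real_derivative - (q - t) / (t * (1 - t))) (at t)" .
  show "q * (ln q - ln t) + (1 - q) * (ln (1 - q) - ln (1 - t)) = bernoulli_entropy t q"
    if "t \<in> {0<..<1}" for t
    using that assms by (simp add: bernoulli_entropy_def ln_div)
qed (use assms in auto)

text \<open>The second moment produces the entropy relative to \<open>p0\<close>, whereas the
  entropy condition concerns \<open>p0'\<close>; moving the reference value away from
  \<open>q\<close> only increases the entropy.\<close>

lemma bernoulli_entropy_antimono:
  assumes "0 < p" "p \<le> p0" "p0 \<le> q" "q < 1"
  shows "bernoulli_entropy p0 q \<le> bernoulli_entropy p q"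
proof (rule DERIV_nonpos_imp_nonincreasing[OF assms(2)])
  fix t assume "p \<le> t" "t \<le> p0"
  then have t: "0 < t" "t < 1" "t \<le> q" "0 < q" using assms by auto
  show "\<exists>y. ((\<lambda>t. bernoulli_entropy t q) has_real_derivative y) (at t) \<and> y \<le> 0"
    by (rule exI[of _ "- (q - t) / (t * (1 - t))"])
      (use t assms bernoulli_entropy_has_derivative[of t q] in \<open>auto simp: divide_nonpos_pos\<close>)
qed

lemma bernoulli_entropy_nonneg:
  assumes "0 < p" "p \<le> q" "q < 1"
  shows "0 \<le> bernoulli_entropy p q"
  using bernoulli_entropy_antimono[of p q q] assms by (simp add: bernoulli_entropy_def)

text \<open>Divide by \<open>2 * q * (1 - p)\<close> and let \<open>p\<close> vary: both sides
  vanish at \<open>p = q\<close>, and their difference is monotone because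
  \<open>1 / q \<le> 1 / t\<close> for \<open>t \<le> q\<close>. The bound is meant for
  \<open>q\<close> comparable with \<open>p\<close>.\<close>

lemma bernoulli_entropy_ge_square:
  assumes "0 < p" "p \<le> q" "q < 1"
  shows "(q - p)\<^sup>2 \<le> 2 * q * (1 - p) * bernoulli_entropy p q"
proof -
  let ?f = "\<lambda>t. bernoulli_entropy t q - (q - t)\<^sup>2 / (2 * q * (1 - t))"
  have "?f q \<le> ?f p"
  proof (rule DERIV_nonpos_imp_nonincreasing[OF assms(2)])
    fix t assume "p \<le> t" "t \<le> q"
    then have t: "0 < t" "t < 1" "t \<le> q" "0 < q" "q < 1" using assms by auto
    let ?D = "- (q - t) / (t * (1 - t)) - (- (q - t) / (q * (1 - t)) + (q - t)\<^sup>2 / (2 * q * (1 - t)\<^sup>2))"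
    have "((\<lambda>t. (q - t)\<^sup>2 / (2 * q * (1 - t))) has_real_derivative
        - (q - t) / (q * (1 - t)) + (q - t)\<^sup>2 / (2 * q * (1 - t)\<^sup>2)) (at t)"
      using t by (auto intro!: derivative_eq_intros simp: divide_simps) (simp add: power2_eq_square algebra_simps)
    then have "(?f has_real_derivative ?D) (at t)"
      using t by (intro DERIV_diff bernoulli_entropy_has_derivative) auto
    moreover have "?D \<le> 0"
    proof -
      have "(q - t) / (q * (1 - t)) \<le> (q - t) / (t * (1 - t))"
        using t by (intro divide_left_mono mult_right_mono) auto
      moreover have "0 \<le> (q - t)\<^sup>2 / (2 * q * (1 - t)\<^sup>2)" using t by simp
      moreover have "- (q - t) / (t * (1 - t)) = - ((q - t) / (t * (1 - t)))"
        "- (q - t) / (q * (1 - t)) = - ((q - t) / (q * (1 - t)))"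
        by (simp_all only: minus_divide_left)
      ultimately show ?thesis by linarith
    qed
    ultimately show "\<exists>y. (?f has_real_derivative y) (at t) \<and> y \<le> 0" by blast
  qed
  moreover have "?f q = 0" using assms by (simp add: bernoulli_entropy_def)
  ultimately have "(q - p)\<^sup>2 / (2 * q * (1 - p)) \<le> bernoulli_entropy p q" by simp
  then show ?thesis using assms by (simp add: pos_divide_le_eq mult.commute)
qed

text \<open>The counterpart for large \<open>q / p\<close>: the non-edge term is at least
  \<open>- (q - p)\<close> by \<open>ln x \<le> x - 1\<close>.\<close>

lemma bernoulli_entropy_ge_log:
  assumes "0 < p" "p < 1" "0 < q" "q < 1"
  shows "q * ln (q / p) - (q - p) \<le> bernoulli_entropy p q"
proof -
  have "(1 - q) * ln ((1 - p) / (1 - q)) \<le> (1 - q) * ((1 - p) / (1 - q) - 1)"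
    using assms by (intro mult_left_mono ln_le_minus_one) auto
  also have "\<dots> = q - p" using assms by (simp add: field_simps)
  also have "ln ((1 - p) / (1 - q)) = - ln ((1 - q) / (1 - p))" using assms by (simp add: ln_div)
  finally show ?thesis by (simp add: bernoulli_entropy_def)
qed

text \<open>The log likelihood ratio per edge at edge density \<open>q\<close> is the entropy. This
  is how truncation at about \<open>q * num_pairs k\<close> edges brings it into the second
  moment.\<close>

lemma bernoulli_entropy_conv_log_odds:
  assumes "0 < p" "p < 1" "0 < q" "q < 1"
  shows "q * (ln (q / p) + ln ((1 - p) / (1 - q))) - ln ((1 - p) / (1 - q)) = bernoulli_entropy p q"
  using assms by (simp add: bernoulli_entropy_def ln_div algebra_simps)

section \<open>The risk for a fixed number of nodes\<close>

lemma null_prob_bounds: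
  assumes "0 < p" "p \<le> q" "q < 1" "n < N"
  shows "p \<le> null_prob N n p q" "null_prob N n p q \<le> q"
    "0 < null_prob N n p q" "null_prob N n p q < 1"
proof -
  have mono: "num_pairs n \<le> num_pairs N"
    unfolding num_pairs_def using assms by (cases n) (auto intro!: divide_right_mono mult_mono)
  then have "0 \<le> num_pairs n / num_pairs N" "num_pairs n / num_pairs N \<le> 1"
    using num_pairs_nonneg[of n] num_pairs_nonneg[of N]
    by (auto simp: divide_le_eq_1 zero_less_divide_iff intro!: divide_nonneg_nonneg)
  then have "0 \<le> (q - p) * (num_pairs n / num_pairs N)" "(q - p) * (num_pairs n / num_pairs N) \<le> (q - p) * 1"
    using assms by (intro mult_nonneg_nonneg mult_left_mono; simp)+
  then show 1: "p \<le> null_prob N n p q" "null_prob N n p q \<le> q" unfolding null_prob_def by auto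
  show "0 < null_prob N n p q" "null_prob N n p q < 1" using 1 assms by auto
qed

lemma null_law_prob:
  assumes "0 < p" "p \<le> q" "q < 1" "n < N"
  shows "measure_pmf.prob (null_law N n p q) {W. P W}
    = (\<Sum>X\<in>{X\<in>Pow (node_pairs N). P (matrix_of_pairs (\<lambda>e. e \<in> X))}.
         config_weight (node_pairs N) (\<lambda>_. null_prob N n p q) X)"
proof -
  have "case_prod (\<lambda>i j. null_prob N n p q) = (\<lambda>_ :: nat \<times> nat. null_prob N n p q)" by auto
  then show ?thesis
    unfolding null_law_def using null_prob_bounds[OF assms] by (subst prob_random_graph) auto
qed

lemma alt_law_prob:
  assumes "0 < p" "p \<le> q" "q < 1"
  shows "measure_pmf.prob (alt_law N p q S) {W. P W}
    = (\<Sum>X\<in>{X\<in>Pow (node_pairs N). P (matrix_of_pairs (\<lambda>e. e \<in> X))}.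
         config_weight (node_pairs N) (planted_prob p q (inner_pairs S)) X)"
proof -
  have "config_weight (node_pairs N) (case_prod (\<lambda>i j. if i \<in> S \<and> j \<in> S then q else p)) X
      = config_weight (node_pairs N) (planted_prob p q (inner_pairs S)) X" for X
    unfolding config_weight_def
    by (rule prod.cong) (auto simp: planted_prob_def inner_pairs_def node_pairs_def split: if_splits)
  then show ?thesis unfolding alt_law_def using assms by (subst prob_random_graph) auto
qed

text \<open>Separates probability from calculus: \<open>tail\<close> controls the mass lost by
  truncation, \<open>cost\<close> the second moment for large overlaps, \<open>\<tau>\<close> and
  \<open>\<kappa>\<close> that for small ones, and \<open>total\<close> adds up the errors.\<close>

lemma test_risk_ge:
  fixes N n :: nat and p q c d l M y t \<epsilon> \<tau> \<kappa> :: real and T :: graph_test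
  assumes pq: "0 < p" "p \<le> q" "q < 1" and n: "0 < n" "n < N" and c: "c > 0" and d: "d > 0"
  defines "l \<equiv> ln (real N / real n)"
    and "p0 \<equiv> null_prob N n p q"
    and "t \<equiv> real n * exp (- ln (real N / real n) / 4)"
  defines "\<gamma> \<equiv> (q - p)\<^sup>2 / (p0 * (1 - p0))"
    and "\<theta> \<equiv> ln (q / p0) + ln ((1 - p0) / (1 - q))"
    and "\<mu> \<equiv> real n ^ 2 / real N"
  assumes tail: "\<And>k. k \<le> n \<Longrightarrow> t < real k \<Longrightarrow>
      \<exists>s\<ge>0. - s * (q * num_pairs k + y * real k) + q * num_pairs k * (exp s - 1)
              \<le> - (real k * (1 + ln (real n / real k) + M))"
    and cost: "\<And>k. k \<le> n \<Longrightarrow> t < real k \<Longrightarrow>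
      num_pairs k * bernoulli_entropy p0 q + \<theta> * y * real k + \<gamma> * (num_pairs n / num_pairs N) * num_pairs k
        \<le> real k * (l * ((1 - \<epsilon>) * (real k / real n) + \<epsilon> / 8))"
    and \<epsilon>: "0 < \<epsilon>" "\<epsilon> \<le> 1 / 2" and l: "l \<ge> 8 / \<epsilon>"
    and \<tau>: "3 / 2 * \<gamma> * \<mu> * sqrt \<mu> \<le> \<tau>" "0 < \<tau>" "\<tau> \<le> 1 / 2"
    and \<kappa>: "\<gamma> * t / 2 \<le> \<kappa>" "0 < \<kappa>" "\<kappa> \<le> 1 / 20"
    and M: "M \<ge> 1" "2 * exp (- M) \<le> c"
    and total: "exp d + exp (1 - d / (2 * \<tau>)) + exp (- d / (20 * \<kappa>)) + 2 * exp (- \<epsilon> * l / 8) \<le> 1 + c"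
  shows "test_risk N n p q T \<ge> 1 - 2 * sqrt c"
proof -
  let ?A = "node_pairs N"
  let ?\<S> = "subsets_of_size N n"
  let ?q = "\<lambda>S. config_weight ?A (planted_prob p q (inner_pairs S))"
  let ?p = "config_weight ?A (\<lambda>_. p0)"
  define w where "w k = q * num_pairs k + y * real k" for k
  let ?G = "sparse_subgraphs t w"
  define r where "r S X = of_bool (?G S X) * ?q S X" for S X
  note p0b = null_prob_bounds[OF pq n(2), folded p0_def]
  have t: "t \<ge> 0" by (simp add: t_def)
  have finA: "finite (Pow ?A)" using finite_node_pairs by simp
  have q_nonneg: "?q S X \<ge> 0" for S X
    by (rule config_weight_nonneg) (use pq in \<open>auto simp: planted_prob_def\<close>)
  have p_pos: "?p X > 0" for X by (rule config_weight_pos) (use p0b in auto)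
  have \<gamma>: "\<gamma> \<ge> 0" using p0b by (simp add: \<gamma>_def)
  have S: "S \<subseteq> {1..N}" "card S = n" "finite S" "inner_pairs S \<subseteq> ?A" "real (card (inner_pairs S)) = num_pairs n"
    if "S \<in> ?\<S>" for S
  proof -
    show 1: "S \<subseteq> {1..N}" "card S = n" "finite S" using that finite_subset by (auto simp: subsets_of_size_def)
    then show "inner_pairs S \<subseteq> ?A" unfolding node_pairs_eq_inner_pairs by (intro inner_pairs_mono)
    show "real (card (inner_pairs S)) = num_pairs n" using 1 by (simp add: card_inner_pairs)
  qed
  have ne: "?\<S> \<noteq> {}"
  proof -
    have "{1..n} \<in> ?\<S>" using n by (auto simp: subsets_of_size_def)
    then show ?thesis by blast
  qed
  have first: "(\<Sum>X\<in>Pow ?A. r S X) \<ge> 1 - c" if "S \<in> ?\<S>" for S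
  proof -
    have "1 = (\<Sum>X\<in>Pow ?A. ?q S X)" using sum_config_weight[OF finite_node_pairs] by simp
    also have "\<dots> = (\<Sum>X\<in>Pow ?A. r S X + of_bool (\<not> ?G S X) * ?q S X)"
      by (rule sum.cong) (auto simp: r_def)
    also have "\<dots> = (\<Sum>X\<in>Pow ?A. r S X) + (\<Sum>X\<in>Pow ?A. of_bool (\<not> ?G S X) * ?q S X)"
      by (rule sum.distrib)
    also have "(\<Sum>X\<in>Pow ?A. of_bool (\<not> ?G S X) * ?q S X) = (\<Sum>X\<in>{X\<in>Pow ?A. \<not> ?G S X}. ?q S X)"
      by (rule sum.mono_neutral_cong_right) (use finA in auto)
    also have "\<dots> \<le> 2 * exp (- M)"
      by (rule not_sparse_weight_le[OF S(1,2)[OF that]]) (use pq t M tail in \<open>auto simp: w_def\<close>)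
    finally show ?thesis using M by simp
  qed
  have second: "(\<Sum>S\<in>?\<S>. \<Sum>X\<in>Pow ?A. r S0 X * r S X / ?p X) \<le> (1 + c) * card ?\<S>"
    if S0: "S0 \<in> ?\<S>" for S0
  proof -
    let ?I = "\<lambda>S. \<Sum>X\<in>Pow ?A. r S0 X * r S X / ?p X"
    let ?R = "\<lambda>S X. ?q S0 X * ?q S X / ?p X"
    have R: "?R S X \<ge> 0" for S X using q_nonneg p_pos[of X] by simp
    have planted: "planted_pair ?A (inner_pairs S0) (inner_pairs S) (card (inner_pairs S0)) p q
          (real (card (inner_pairs S0)) / real (card ?A)) p0" if "S \<in> ?\<S>" for S
    proof
      show "card (inner_pairs S) = card (inner_pairs S0)"
        using S(5)[OF that] S(5)[OF S0] by simp
      have "num_pairs N > 0" using n by (simp add: num_pairs_def)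
      then show "0 < card ?A" using card_node_pairs[of N] by simp
      show "p0 = p + (q - p) * (real (card (inner_pairs S0)) / real (card ?A))"
        by (simp add: p0_def null_prob_def S(5)[OF S0] card_node_pairs)
    qed (use finite_node_pairs S that S0 pq in auto)
    have low: "?I S \<le> exp (\<gamma> * (num_pairs (card (S0 \<inter> S)) - num_pairs n ^ 2 / num_pairs N))"
      if "S \<in> ?\<S>" for S
    proof -
      interpret planted_pair ?A "inner_pairs S0" "inner_pairs S" "card (inner_pairs S0)" p q
          "real (card (inner_pairs S0)) / real (card ?A)" p0 by (rule planted[OF that])
      \<comment> \<open>For small overlaps the truncation is simply dropped.\<close>
      have "?I S \<le> (\<Sum>X\<in>Pow ?A. ratio_sq X)"
        unfolding ratio_sq_def by (rule sum_mono) (use R in \<open>auto simp: r_def\<close>)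
      also note second_moment
      finally show ?thesis
        using S(3)[OF S0] by (simp add: \<gamma>_def S(5)[OF S0] card_node_pairs inner_pairs_Int[symmetric] card_inner_pairs)
    qed
    define g where "g k = exp (num_pairs k * bernoulli_entropy p0 q + \<theta> * y * real k
        + \<gamma> * (num_pairs n / num_pairs N) * num_pairs k)" for k
    have high: "?I S \<le> g (card (S0 \<inter> S))" if "S \<in> ?\<S>" "t < real (card (S0 \<inter> S))" for S
    proof -
      interpret planted_pair ?A "inner_pairs S0" "inner_pairs S" "card (inner_pairs S0)" p q
          "real (card (inner_pairs S0)) / real (card ?A)" p0 by (rule planted[OF that(1)])
      let ?k = "card (S0 \<inter> S)" and ?E = "\<lambda>X. card (X \<inter> (inner_pairs S0 \<inter> inner_pairs S))"
      have k2: "real (card (inner_pairs S0 \<inter> inner_pairs S)) = num_pairs ?k"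
        using S(3)[OF S0] by (simp add: inner_pairs_Int[symmetric] card_inner_pairs)
      have "?I S \<le> (\<Sum>X\<in>Pow ?A. of_bool (real (?E X) \<le> w ?k) * ratio_sq X)"
      proof (rule sum_mono)
        fix X
        \<comment> \<open>The event of \<open>S0\<close> alone is used, applied to its subset
          \<open>S0 \<inter> S\<close>.\<close>
        have "real (?E X) \<le> w ?k" if "?G S0 X"
          using that \<open>t < real ?k\<close> unfolding sparse_subgraphs_def inner_pairs_Int[symmetric] by auto
        then show "r S0 X * r S X / ?p X \<le> of_bool (real (?E X) \<le> w ?k) * ratio_sq X"
          using R[of X S] unfolding ratio_sq_def r_def by auto
      qed
      also have "\<dots> = (\<Sum>X\<in>{X\<in>Pow ?A. real (?E X) \<le> w ?k}. ratio_sq X)"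
        by (rule sum.mono_neutral_cong_right) (use finA in auto)
      also note truncated_second_moment
      finally have "?I S \<le> exp (\<theta> * w ?k - ln ((1 - p0) / (1 - q)) * num_pairs ?k
          + \<gamma> * (num_pairs n / num_pairs N) * num_pairs ?k)"
        unfolding \<theta>_def \<gamma>_def k2 S(5)[OF S0] card_node_pairs .
      also have "\<theta> * w ?k - ln ((1 - p0) / (1 - q)) * num_pairs ?k
          = num_pairs ?k * (q * \<theta> - ln ((1 - p0) / (1 - q))) + \<theta> * y * real ?k"
        by (simp add: w_def algebra_simps)
      also have "q * \<theta> - ln ((1 - p0) / (1 - q)) = bernoulli_entropy p0 q"
        unfolding \<theta>_def by (rule bernoulli_entropy_conv_log_odds) (use p0b pq in auto)
      finally show ?thesis unfolding g_def .
    qed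
    have "(\<Sum>S\<in>?\<S>. ?I S) = (\<Sum>S\<in>{S\<in>?\<S>. real (card (S0 \<inter> S)) \<le> t}. ?I S) + (\<Sum>S\<in>{S\<in>?\<S>. t < real (card (S0 \<inter> S))}. ?I S)"
      by (subst sum.union_disjoint[symmetric]) (auto intro!: sum.cong finite_subsets_of_size)
    also have "\<dots> \<le> (\<Sum>S\<in>{S\<in>?\<S>. real (card (S0 \<inter> S)) \<le> t}. exp (\<gamma> * (num_pairs (card (S0 \<inter> S)) - num_pairs n ^ 2 / num_pairs N)))
         + (\<Sum>S\<in>{S\<in>?\<S>. t < real (card (S0 \<inter> S))}. g (card (S0 \<inter> S)))"
      by (intro add_mono sum_mono) (use low high in auto)
    also have "\<dots> \<le> real (N choose n) * (exp d + exp (1 - d / (2 * \<tau>)) + exp (- d / (20 * \<kappa>)))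
        + real (N choose n) * (2 * exp (- \<epsilon> * l / 8))"
    proof (rule add_mono)
      show "(\<Sum>S\<in>{S\<in>?\<S>. real (card (S0 \<inter> S)) \<le> t}. exp (\<gamma> * (num_pairs (card (S0 \<inter> S)) - num_pairs n ^ 2 / num_pairs N)))
         \<le> real (N choose n) * (exp d + exp (1 - d / (2 * \<tau>)) + exp (- d / (20 * \<kappa>)))"
        by (rule small_overlap_sum[OF S0]) (use n \<gamma> d \<tau> \<kappa> in \<open>auto simp: \<mu>_def\<close>)
      show "(\<Sum>S\<in>{S\<in>?\<S>. t < real (card (S0 \<inter> S))}. g (card (S0 \<inter> S)))
         \<le> real (N choose n) * (2 * exp (- \<epsilon> * l / 8))"
        unfolding t_def l_def
        by (rule large_overlap_sum[OF S0 n \<epsilon>]) (use l cost in \<open>auto simp: l_def t_def g_def\<close>)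
    qed
    also have "\<dots> = real (N choose n) * (exp d + exp (1 - d / (2 * \<tau>)) + exp (- d / (20 * \<kappa>)) + 2 * exp (- \<epsilon> * l / 8))"
      by (simp add: algebra_simps)
    also have "\<dots> \<le> real (N choose n) * (1 + c)" by (intro mult_left_mono total) auto
    finally show ?thesis by (simp add: card_subsets_of_size mult.commute)
  qed
  let ?R = "{X\<in>Pow ?A. T (matrix_of_pairs (\<lambda>e. e \<in> X))}"
  have "1 - 2 * sqrt c \<le> (\<Sum>X\<in>?R. ?p X) + Max ((\<lambda>S. \<Sum>X\<in>Pow ?A - ?R. ?q S X) ` ?\<S>)"
  proof (rule mixture_testing_bound[where r = r])
    show "(1 - c) * card ?\<S> \<le> (\<Sum>S\<in>?\<S>. \<Sum>X\<in>Pow ?A. r S X)"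
      using sum_mono[of ?\<S> "\<lambda>_. 1 - c" "\<lambda>S. \<Sum>X\<in>Pow ?A. r S X"] first by (simp add: mult.commute)
    have "(\<Sum>S0\<in>?\<S>. \<Sum>S\<in>?\<S>. \<Sum>X\<in>Pow ?A. r S0 X * r S X / ?p X) \<le> (\<Sum>S0\<in>?\<S>. (1 + c) * card ?\<S>)"
      by (intro sum_mono second)
    then show "(\<Sum>S0\<in>?\<S>. \<Sum>S\<in>?\<S>. \<Sum>X\<in>Pow ?A. r S0 X * r S X / ?p X) \<le> (1 + c) * card ?\<S> * card ?\<S>"
      by (simp add: mult_ac)
    show "sum ?p (Pow ?A) = 1" by (rule sum_config_weight[OF finite_node_pairs])
  qed (use finA finite_subsets_of_size ne p_pos q_nonneg c in \<open>auto simp: r_def\<close>)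
  also have "\<dots> = test_risk N n p q T"
  proof -
    have "Pow ?A - ?R = {X\<in>Pow ?A. \<not> T (matrix_of_pairs (\<lambda>e. e \<in> X))}" by auto
    then show ?thesis
      unfolding test_risk_def null_law_prob[OF pq n(2)] alt_law_prob[OF pq] p0_def subsets_of_size_def by simp
  qed
  finally show ?thesis .
qed

section \<open>Choice of the truncation level\<close>

text \<open>If \<open>ln (q / p) > 2\<close>, the logarithmic bound makes the entropy at least
  \<open>q\<close>, so \<open>q / p\<close> is at most
  \<open>n H / (n p) \<le> 2 * l * max 1 (1 / (n p))\<close>, where \<open>H\<close> is the entropy.
  Taking logarithms, the assumption on \<open>1 / (n p)\<close> bounds \<open>ln (q / p)\<close> by
  a small multiple of \<open>l\<close>.\<close>

lemma log_ratio_le: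
  fixes l \<zeta> :: real
  assumes pq: "0 < p" "p \<le> q" "q < 1" and n: "n > 0" and l: "l > 0"
    and H: "real n * bernoulli_entropy p q \<le> 2 * l"
    and np: "ln (max 1 (1 / (real n * p))) \<le> \<zeta> * l" and ln_l: "ln (2 * l) \<le> \<zeta> * l" and \<zeta>: "\<zeta> > 0"
  shows "ln (q / p) \<le> 2 + 2 * \<zeta> * l"
proof (cases "ln (q / p) \<le> 2")
  case True
  then show ?thesis using \<zeta> l by (simp add: add_increasing2)
next
  case False
  have np0: "real n * p > 0" using n pq by simp
  have "q \<le> q * (ln (q / p) - 1)" using False pq by simp
  also have "\<dots> \<le> q * ln (q / p) - (q - p)" using pq by (simp add: right_diff_distrib)
  also have "\<dots> \<le> bernoulli_entropy p q" by (rule bernoulli_entropy_ge_log) (use pq in auto)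
  finally have "q / p \<le> bernoulli_entropy p q / p" using pq by (simp add: divide_right_mono)
  also have "\<dots> = real n * bernoulli_entropy p q * (1 / (real n * p))" using n by simp
  also have "\<dots> \<le> 2 * l * max 1 (1 / (real n * p))" by (rule mult_mono[OF H]) (use np0 l in auto)
  finally have "ln (q / p) \<le> ln (2 * l * max 1 (1 / (real n * p)))"
    using pq l by (subst ln_le_cancel_iff) (auto simp: less_max_iff_disj)
  also have "\<dots> = ln (2 * l) + ln (max 1 (1 / (real n * p)))"
    using l by (intro ln_mult_pos) (auto simp: less_max_iff_disj)
  finally show ?thesis using np ln_l by simp
qed

text \<open>Here \<open>1/(1 - q) \<le> D\<close> controls the contribution of the non-edges to the log odds ratio \<open>\<theta>\<close>.\<close>

lemma log_odds_bounds:
  fixes p p0 q D :: real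
  assumes pq: "0 < p" "p \<le> p0" "p0 \<le> q" "q < 1" and D: "1 \<le> D * (1 - q)" "D \<ge> 1"
  defines "\<theta> \<equiv> ln (q / p0) + ln ((1 - p0) / (1 - q))"
  shows "0 \<le> \<theta>" "\<theta> \<le> ln (q / p) + ln D" "\<theta> \<le> (1 + D) * ((q - p) / p)" "q * \<theta> \<le> (1 + D) * (q * ln (q / p))"
proof -
  show "0 \<le> \<theta>" unfolding \<theta>_def using pq by (intro add_nonneg_nonneg ln_ge_zero) auto
  have ln1: "ln (q / p0) \<le> ln (q / p)"
    using pq by (subst ln_le_cancel_iff) (auto intro!: divide_left_mono)
  have inv: "1 / (1 - q) \<le> D" using D pq by (simp add: pos_divide_le_eq)
  have "(1 - p0) / (1 - q) \<le> 1 / (1 - q)" using pq by (intro divide_right_mono) auto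
  then have "ln ((1 - p0) / (1 - q)) \<le> ln D" using pq D inv by (subst ln_le_cancel_iff) auto
  then show "\<theta> \<le> ln (q / p) + ln D" using ln1 by (simp add: \<theta>_def)
  have "ln ((1 - p0) / (1 - q)) \<le> (1 - p0) / (1 - q) - 1" using pq by (intro ln_le_minus_one) auto
  also have "\<dots> = (q - p0) * (1 / (1 - q))" using pq by (simp add: field_simps)
  also have "\<dots> \<le> (q - p) * D" using pq inv by (intro mult_mono) auto
  finally have ln2: "ln ((1 - p0) / (1 - q)) \<le> D * (q - p)" by (simp add: mult.commute)
  have "ln (q / p) \<le> q / p - 1" using pq by (intro ln_le_minus_one) auto
  also have "\<dots> = (q - p) / p" using pq by (simp add: field_simps)
  finally have ln3: "ln (q / p) \<le> (q - p) / p" .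
  have "(q - p) * p \<le> (q - p) * 1" using pq by (intro mult_left_mono) auto
  then have "q - p \<le> (q - p) / p" using pq by (simp add: pos_le_divide_eq)
  then have "D * (q - p) \<le> D * ((q - p) / p)" using D by (intro mult_left_mono) auto
  then show "\<theta> \<le> (1 + D) * ((q - p) / p)" using ln1 ln2 ln3 unfolding \<theta>_def distrib_right by linarith
  have "ln (p / q) \<le> p / q - 1" using pq by (intro ln_le_minus_one) auto
  then have "q * (1 - p / q) \<le> q * ln (q / p)" using pq by (intro mult_left_mono) (auto simp: ln_div)
  moreover have "q * (1 - p / q) = q - p" using pq by (simp add: field_simps)
  ultimately have "q - p \<le> q * ln (q / p)" by simp
  then have "D * (q - p) \<le> D * (q * ln (q / p))" using D by (intro mult_left_mono) auto
  moreover have "q * (D * (q - p)) \<le> 1 * (D * (q - p))" using pq D by (intro mult_right_mono) auto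
  moreover have "q * \<theta> \<le> q * (ln (q / p) + D * (q - p))"
    unfolding \<theta>_def using pq by (intro mult_left_mono add_mono ln1 ln2) auto
  ultimately show "q * \<theta> \<le> (1 + D) * (q * ln (q / p))" by (simp add: algebra_simps)
qed

text \<open>For \<open>ln (q / p) \<le> 2\<close> the quadratic entropy bound applies, with
  \<open>q - p > \<eta> * p\<close> turning the square into a linear bound; the factor
  \<open>exp 4\<close> is \<open>q \<le> exp 2 * p\<close> used twice. For larger ratios the
  logarithmic bound suffices.\<close>

lemma mult_ln_ratio_le_entropy:
  fixes \<eta> :: real
  assumes pq: "0 < p" "q < 1" and \<eta>: "0 < \<eta>" "\<eta> \<le> 1" and r: "1 + \<eta> < q / p"
  shows "q * ln (q / p) \<le> 2 * exp 4 / \<eta> * bernoulli_entropy p q"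
proof -
  have "(1 + \<eta>) * p < q" using r pq by (simp add: pos_less_divide_eq)
  moreover have "p < (1 + \<eta>) * p" using pq \<eta> by simp
  ultimately have q: "p < q" "\<eta> * p < q - p" by (auto simp: distrib_right)
  have H: "0 \<le> bernoulli_entropy p q" by (rule bernoulli_entropy_nonneg) (use pq q in auto)
  have sq: "(q - p)\<^sup>2 \<le> 2 * q * (1 - p) * bernoulli_entropy p q"
    by (rule bernoulli_entropy_ge_square) (use pq q in auto)
  have "2 * q * (1 - p) * bernoulli_entropy p q \<le> 2 * q * 1 * bernoulli_entropy p q"
    using pq q H by (intro mult_right_mono mult_left_mono) auto
  with sq have sq: "(q - p)\<^sup>2 \<le> 2 * q * bernoulli_entropy p q" by simp
  show ?thesis
  proof (cases "ln (q / p) \<le> 2")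
    case True
    then have "exp (ln (q / p)) \<le> exp 2" by simp
    then have "q / p \<le> exp 2" using pq q by simp
    then have qp: "q \<le> exp 2 * p" using pq by (simp add: pos_divide_le_eq)
    have "ln (q / p) \<le> (q - p) / p"
      using ln_le_minus_one[of "q / p"] pq q by (simp add: diff_divide_distrib)
    then have "q * ln (q / p) \<le> q * ((q - p) / p)" using pq q by (intro mult_left_mono) auto
    also have "\<dots> \<le> (exp 2 * p) * ((q - p) / p)" using pq q qp by (intro mult_right_mono) auto
    also have "\<dots> = exp 2 * (q - p)" using pq by simp
    also have "\<dots> \<le> exp 2 * (2 * exp 2 / \<eta> * bernoulli_entropy p q)"
    proof (intro mult_left_mono)
      have "(q - p) * (\<eta> * p) \<le> (q - p)\<^sup>2" using q by (simp add: power2_eq_square mult_left_mono)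
      also have "\<dots> \<le> 2 * q * bernoulli_entropy p q" by (rule sq)
      also have "\<dots> \<le> 2 * (exp 2 * p) * bernoulli_entropy p q"
        using qp H by (intro mult_right_mono mult_left_mono) auto
      finally have "((q - p) * \<eta>) * p \<le> (2 * exp 2 * bernoulli_entropy p q) * p" by (simp add: mult_ac)
      then have "(q - p) * \<eta> \<le> 2 * exp 2 * bernoulli_entropy p q" using pq by simp
      then show "q - p \<le> 2 * exp 2 / \<eta> * bernoulli_entropy p q" using \<eta> by (simp add: pos_le_divide_eq)
    qed simp
    also have "\<dots> = 2 * exp 4 / \<eta> * bernoulli_entropy p q" by (simp add: exp_add[symmetric])
    finally show ?thesis .
  next
    case False
    have "q * 2 \<le> q * ln (q / p)" using False pq q by (intro mult_left_mono) auto
    moreover have "q * ln (q / p) - (q - p) \<le> bernoulli_entropy p q"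
      by (rule bernoulli_entropy_ge_log) (use pq q in auto)
    ultimately have "q * ln (q / p) \<le> 2 * bernoulli_entropy p q" using pq by linarith
    also have "\<dots> \<le> 2 * exp 4 / \<eta> * bernoulli_entropy p q"
    proof (intro mult_right_mono)
      have "\<eta> \<le> exp 4" using \<eta> one_le_exp_iff[of "4 :: real"] by linarith
      then show "2 \<le> 2 * exp 4 / \<eta>" using \<eta> by (simp add: pos_le_divide_eq)
    qed (use H in auto)
    finally show ?thesis .
  qed
qed

text \<open>The slack \<open>y\<close> in the truncation level \<open>q k(k - 1)/2 + y k\<close> must be cheap, \<open>\<theta> y \<le> \<eta> l\<close>, and yet
  large enough to survive the union bound over all subsets of size \<open>k\<close>. It has to be of order
  \<open>sqrt (q n)\<close> if \<open>q/p\<close> is close to \<open>1\<close> and of order \<open>q n\<close> otherwise.\<close>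

lemma truncation_slack_exists:
  fixes D C \<eta> \<eta>1 A Y M l \<zeta> :: real
  assumes pq: "0 < p" "p \<le> p0" "p0 \<le> q" "q < 1" and D: "1 \<le> D * (1 - q)" "D \<ge> 1" and n: "n > 0"
    and \<eta>: "0 < \<eta>" "\<eta> \<le> 1" and M: "M \<ge> 1"
  defines "C \<equiv> 1 + D"
  defines "\<eta>1 \<equiv> \<eta> / C"
  defines "A \<equiv> 4 * C * exp 4 / (\<eta>1 * \<eta>)"
  defines "Y \<equiv> 2 * (1 + A) * (2 + A + M)"
  defines "\<theta> \<equiv> ln (q / p0) + ln ((1 - p0) / (1 - q))"
  assumes H: "real n * bernoulli_entropy p q \<le> 2 * l"
    and l: "1 + M \<le> l / 4" "l \<ge> 32 * (1 + M) * C\<^sup>2 / \<eta>\<^sup>2" "Y * (2 + ln D) \<le> \<eta> / 2 * l"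
    and ratio: "ln (q / p) \<le> 2 + 2 * \<zeta> * l" and \<zeta>: "Y * (2 * \<zeta>) \<le> \<eta> / 2"
  shows "\<exists>y. \<theta> * y \<le> \<eta> * l \<and> (\<forall>k. 1 \<le> k \<longrightarrow> k \<le> n \<longrightarrow> ln (real n / real k) \<le> l / 4 \<longrightarrow>
      (\<exists>s\<ge>0. - s * (q * num_pairs k + y * real k) + q * num_pairs k * (exp s - 1)
              \<le> - (real k * (1 + ln (real n / real k) + M))))"
proof -
  note \<theta> = log_odds_bounds[OF pq D, folded \<theta>_def C_def]
  have C: "C \<ge> 2" using D by (simp add: C_def)
  have \<eta>1: "0 < \<eta>1" "\<eta>1 \<le> 1" using \<eta> C by (auto simp: \<eta>1_def)
  have l0: "l > 0" using l M by linarith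
  have A: "A > 0" using C \<eta> \<eta>1 by (simp add: A_def)
  have H0: "0 \<le> bernoulli_entropy p q" by (rule bernoulli_entropy_nonneg) (use pq in auto)
  show ?thesis
  proof (cases "q / p \<le> 1 + \<eta>1")
    case True
    \<comment> \<open>The square root is the deviation scale required by the dense tail bound, and
      \<open>l\<close> serves its regime \<open>s = 1\<close>. The part \<open>l\<close> is cheap
      because \<open>\<theta> \<le> \<eta>\<close> in this case.\<close>
    define y where "y = max l (sqrt (2 * (1 + M) * (q * real n)))"
    have "(q - p) / p \<le> \<eta>1" using True pq by (simp add: diff_divide_distrib)
    then have "C * ((q - p) / p) \<le> C * \<eta>1" using C by (intro mult_left_mono) auto
    also have "\<dots> = \<eta>" using C by (simp add: \<eta>1_def)
    finally have \<theta>\<eta>: "\<theta> \<le> \<eta>" using \<theta>(3) by simp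
    \<comment> \<open>From \<open>\<theta> \<le> C (q - p) / p\<close>, the quadratic entropy bound
      and \<open>q / p \<le> 2\<close>. Hence the square root part of \<open>y\<close> costs only
      order \<open>sqrt l\<close>, less than \<open>\<eta> * l\<close> for large
      \<open>l\<close>.\<close>
    have sq: "\<theta>\<^sup>2 * (q * real n) \<le> 16 * C\<^sup>2 * l"
    proof -
      have "\<theta>\<^sup>2 \<le> (C * ((q - p) / p))\<^sup>2" using \<theta> by (intro power_mono)
      also have "\<dots> = C\<^sup>2 * ((q - p)\<^sup>2 / p\<^sup>2)" by (simp add: power_mult_distrib power_divide)
      also have "\<dots> \<le> C\<^sup>2 * (2 * q * 1 * bernoulli_entropy p q / p\<^sup>2)"
      proof (intro mult_left_mono divide_right_mono)
        have "(q - p)\<^sup>2 \<le> 2 * q * (1 - p) * bernoulli_entropy p q"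
          by (rule bernoulli_entropy_ge_square) (use pq in auto)
        also have "\<dots> \<le> 2 * q * 1 * bernoulli_entropy p q"
          using pq H0 by (intro mult_right_mono mult_left_mono) auto
        finally show "(q - p)\<^sup>2 \<le> 2 * q * 1 * bernoulli_entropy p q" .
      qed auto
      finally have "\<theta>\<^sup>2 * (q * real n) \<le> C\<^sup>2 * (2 * q * 1 * bernoulli_entropy p q / p\<^sup>2) * (q * real n)"
        using pq by (intro mult_right_mono) auto
      also have "\<dots> = 2 * C\<^sup>2 * (q / p)\<^sup>2 * (real n * bernoulli_entropy p q)"
        by (simp add: power2_eq_square)
      also have "\<dots> \<le> 2 * C\<^sup>2 * 2\<^sup>2 * (2 * l)"
        by (intro mult_mono[OF mult_left_mono H] power_mono) (use True \<eta>1 pq H0 in auto)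
      finally show ?thesis by simp
    qed
    have "\<theta> * sqrt (2 * (1 + M) * (q * real n)) \<le> \<eta> * l"
    proof (rule power2_le_imp_le)
      have "(\<theta> * sqrt (2 * (1 + M) * (q * real n)))\<^sup>2 = 2 * (1 + M) * (\<theta>\<^sup>2 * (q * real n))"
        using M pq by (simp add: power_mult_distrib)
      also have "\<dots> \<le> 2 * (1 + M) * (16 * C\<^sup>2 * l)" using sq M by (intro mult_left_mono) auto
      also have "\<dots> = (32 * (1 + M) * C\<^sup>2) * l" by simp
      also have "\<dots> \<le> (\<eta>\<^sup>2 * l) * l"
        using l(2) l0 \<eta> by (intro mult_right_mono) (auto simp: pos_divide_le_eq mult.commute)
      finally show "(\<theta> * sqrt (2 * (1 + M) * (q * real n)))\<^sup>2 \<le> (\<eta> * l)\<^sup>2"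
        by (simp add: power2_eq_square mult_ac)
    qed (use \<eta> l0 in auto)
    moreover have "\<theta> * l \<le> \<eta> * l" using \<theta>\<eta> l0 by (intro mult_right_mono) auto
    ultimately have "\<theta> * y \<le> \<eta> * l" by (simp add: y_def max_def)
    moreover have "2 * (1 + M) * (q * real n) \<le> y\<^sup>2"
    proof -
      have nn: "0 \<le> 2 * (1 + M) * (q * real n)" using M pq by simp
      then have "(sqrt (2 * (1 + M) * (q * real n)))\<^sup>2 \<le> y\<^sup>2"
        unfolding y_def by (intro power_mono) auto
      then show ?thesis using nn by simp
    qed
    ultimately show ?thesis
      using pq M l by (intro exI[of _ y] conjI allI impI tail_exponent_dense) (auto simp: y_def)
  next
    case False
    \<comment> \<open>Here \<open>q \<theta> n\<close> is only of order \<open>l\<close>; the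
      constant \<open>A\<close> is the factor that brings the cost of \<open>q n / A\<close> down to
      \<open>\<eta> * l\<close>. The constant \<open>Y\<close> is the minimal slack of the sparse
      tail bound for this \<open>A\<close>.\<close>
    define y where "y = max Y (q * real n / A)"
    have "q * \<theta> \<le> C * (2 * exp 4 / \<eta>1 * bernoulli_entropy p q)"
      by (rule order_trans[OF \<theta>(4)], rule mult_left_mono[OF mult_ln_ratio_le_entropy])
        (use C False pq \<eta>1 in auto)
    then have "q * \<theta> * real n \<le> C * (2 * exp 4 / \<eta>1 * bernoulli_entropy p q) * real n"
      by (intro mult_right_mono) auto
    also have "\<dots> = (C * (2 * exp 4 / \<eta>1)) * (real n * bernoulli_entropy p q)" by simp
    also have "\<dots> \<le> (C * (2 * exp 4 / \<eta>1)) * (2 * l)" using C \<eta>1 by (intro mult_left_mono H) auto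
    also have "\<dots> = \<eta> * l * A" using \<eta> \<eta>1 by (simp add: A_def)
    finally have "\<theta> * (q * real n / A) \<le> \<eta> * l" using A by (simp add: pos_divide_le_eq mult_ac)
    \<comment> \<open>A constant slack is affordable because \<open>\<theta>\<close> is at most
      \<open>ln (q / p) + ln D\<close>, a small multiple of \<open>l\<close> plus a
      constant.\<close>
    moreover have "\<theta> * Y \<le> \<eta> * l"
    proof -
      have Y: "Y \<ge> 0" unfolding Y_def using A M by simp
      have "\<theta> * Y \<le> (2 + 2 * \<zeta> * l + ln D) * Y" using \<theta>(2) ratio Y by (intro mult_right_mono) auto
      also have "\<dots> = Y * (2 + ln D) + Y * (2 * \<zeta>) * l" by (simp add: algebra_simps)
      also have "\<dots> \<le> \<eta> / 2 * l + \<eta> / 2 * l" using l l0 \<zeta> by (intro add_mono mult_right_mono) auto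
      finally show ?thesis by simp
    qed
    ultimately have "\<theta> * y \<le> \<eta> * l" by (simp add: y_def max_def)
    moreover have "q * real n \<le> A * y"
      using A mult_left_mono[of "q * real n / A" y A] by (simp add: y_def)
    ultimately show ?thesis
      using pq M A by (intro exI[of _ y] conjI allI impI tail_exponent_sparse[where A = A]) (auto simp: y_def Y_def)
  qed
qed

section \<open>Choice of the constants\<close>

text \<open>The excess \<open>c\<close> is split into quarters: one for
  \<open>exp d = 1 + c / 4\<close>, one for each of the two small overlap tails, and one reserved
  for the large overlaps.\<close>

lemma error_budget_exists:
  fixes c :: real
  assumes c: "c > 0"
  obtains d \<tau> \<kappa> M :: real where "d > 0" "0 < \<tau>" "\<tau> \<le> 1 / 2" "0 < \<kappa>" "\<kappa> \<le> 1 / 20" "M \<ge> 1"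
    "2 * exp (- M) \<le> c" "exp d + exp (1 - d / (2 * \<tau>)) + exp (- d / (20 * \<kappa>)) + c / 4 \<le> 1 + c"
proof -
  define B where "B = 1 + \<bar>ln (c / 4)\<bar>"
  define d where "d = ln (1 + c / 4)"
  define \<tau> where "\<tau> = min (1 / 2) (d / (2 * B))"
  define \<kappa> where "\<kappa> = min (1 / 20) (d / (20 * B))"
  define M where "M = max 1 (ln (2 / c))"
  have B: "B \<ge> 1" by (simp add: B_def)
  have d: "d > 0" using c by (simp add: d_def)
  have \<tau>: "0 < \<tau>" "\<tau> \<le> 1 / 2" "\<tau> \<le> d / (2 * B)" and \<kappa>: "0 < \<kappa>" "\<kappa> \<le> 1 / 20" "\<kappa> \<le> d / (20 * B)"
    using B d by (auto simp: \<tau>_def \<kappa>_def)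
  have "B \<le> d / (2 * \<tau>)" "B \<le> d / (20 * \<kappa>)"
    using \<tau> \<kappa> B by (auto simp: pos_le_divide_eq mult_ac)
  then have "1 - d / (2 * \<tau>) \<le> ln (c / 4)" "- d / (20 * \<kappa>) \<le> ln (c / 4)" by (auto simp: B_def)
  then have "exp (1 - d / (2 * \<tau>)) \<le> exp (ln (c / 4))" "exp (- d / (20 * \<kappa>)) \<le> exp (ln (c / 4))"
    by (simp_all only: exp_le_cancel_iff)
  moreover have "exp d = 1 + c / 4" using c by (simp add: d_def)
  ultimately have "exp d + exp (1 - d / (2 * \<tau>)) + exp (- d / (20 * \<kappa>)) + c / 4 \<le> 1 + c"
    using c by simp
  moreover have "2 * exp (- M) \<le> c"
  proof -
    have "exp (- M) \<le> exp (- ln (2 / c))" by (simp add: M_def)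
    also have "\<dots> = c / 2" using c by (simp add: exp_minus)
    finally show ?thesis by simp
  qed
  ultimately show ?thesis using that[of d \<tau> \<kappa> M] d \<tau> \<kappa> by (simp add: M_def)
qed

text \<open>With \<open>x = n\<close> and \<open>y = N\<close> the right side is
  \<open>\<mu> * sqrt \<mu>\<close>, the form in which the total degree condition meets the overlap
  bound.\<close>

lemma powr_ratio_square:
  fixes x y :: real
  assumes "x > 0" "y > 0"
  shows "(x powr (3/2) / y powr (3/4))\<^sup>2 = x\<^sup>2 / y * sqrt (x\<^sup>2 / y)"
proof -
  have "(x powr (3/2))\<^sup>2 = x powr 3" using assms by (subst powr_power) auto
  also have "\<dots> = x\<^sup>2 * x" using assms by (simp add: powr_numeral power3_eq_cube power2_eq_square)
  finally have x: "(x powr (3/2))\<^sup>2 = x\<^sup>2 * x" .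
  have "(y powr (3/4))\<^sup>2 = y powr (1 + 1 / 2)" using assms by (subst powr_power) auto
  also have "\<dots> = y * sqrt y" using assms by (subst powr_add) (simp add: powr_half_sqrt)
  finally have y: "(y powr (3/4))\<^sup>2 = y * sqrt y" .
  show ?thesis using assms unfolding power_divide x y by (simp add: real_sqrt_divide)
qed

text \<open>The thresholds depend on \<open>\<epsilon>\<close>, \<open>c0\<close> and
  \<open>c\<close> only, not on \<open>N\<close>, so each limit assumption has merely to pass a
  fixed threshold.\<close>

lemma test_risk_ge_of_parameters:
  fixes \<epsilon> c0 c :: real
  assumes \<epsilon>: "0 < \<epsilon>" "\<epsilon> \<le> 1 / 2" and c0: "0 \<le> c0" "c0 < 1" and c: "c > 0"
  obtains L \<zeta> m Z :: real where "\<zeta> > 0" "Z > 0"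
    "\<And>N n p q T. \<lbrakk>0 < p; p \<le> q; q < 1; 0 < n; n < N; null_prob N n p q \<le> c0;
        L \<le> ln (real N / real n); m * ln (real N / real n) \<le> real n;
        ln (max 1 (1 / (real n * p))) \<le> \<zeta> * ln (real N / real n);
        ((q - p) / sqrt p * (real n powr (3/2) / real N powr (3/4)))\<^sup>2 \<le> Z;
        real n * bernoulli_entropy p q \<le> 2 * (1 - \<epsilon>) * ln (real N / real n)\<rbrakk>
      \<Longrightarrow> 1 - 2 * sqrt c \<le> test_risk N n p q T"
proof -
  obtain d \<tau> \<kappa> M :: real where d: "d > 0" and \<tau>: "0 < \<tau>" "\<tau> \<le> 1 / 2" and \<kappa>: "0 < \<kappa>" "\<kappa> \<le> 1 / 20"
    and M: "M \<ge> 1" "2 * exp (- M) \<le> c"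
    and total: "exp d + exp (1 - d / (2 * \<tau>)) + exp (- d / (20 * \<kappa>)) + c / 4 \<le> 1 + c"
    by (rule error_budget_exists[OF c])
  define D where "D = 2 / (1 - c0)"
  \<comment> \<open>Half of the allowance \<open>\<epsilon> / 8\<close> in the large overlap
    exponent; the other half pays for the \<open>\<rho>\<close> term of the truncated second
    moment.\<close>
  define \<eta> where "\<eta> = \<epsilon> / 16"
  define C where "C = 1 + D"
  define \<eta>1 where "\<eta>1 = \<eta> / C"
  define A where "A = 4 * C * exp 4 / (\<eta>1 * \<eta>)"
  define Y where "Y = 2 * (1 + A) * (2 + A + M)"
  \<comment> \<open>The bound \<open>1 / 16\<close> gives
    \<open>q / p \<le> exp (2 + l / 8)\<close>, which the factor \<open>exp (- l / 4)\<close> of the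
    cut outweighs; the other bound makes the constant slack \<open>Y\<close> affordable.\<close>
  define \<zeta> where "\<zeta> = min (1 / 16) (\<eta> / (4 * Y))"
  \<comment> \<open>Chosen so that \<open>4 * l / n \<le> ((1 - c0) / 2)\<^sup>2\<close>.\<close>
  define m where "m = 16 / (1 - c0)\<^sup>2"
  define Z where "Z = 2 / 3 * \<tau> / D"
  have D: "D \<ge> 2" using c0 by (simp add: D_def pos_le_divide_eq)
  have \<eta>: "0 < \<eta>" "\<eta> \<le> 1" using \<epsilon> by (auto simp: \<eta>_def)
  have "A > 0" using D \<eta> by (simp add: A_def C_def \<eta>1_def)
  then have Y: "Y > 0" using M by (simp add: Y_def)
  have \<zeta>: "\<zeta> > 0" "\<zeta> \<le> 1 / 16" "Y * (2 * \<zeta>) \<le> \<eta> / 2"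
  proof -
    show "\<zeta> > 0" "\<zeta> \<le> 1 / 16" using \<eta> Y by (auto simp: \<zeta>_def)
    have "Y * (2 * \<zeta>) \<le> Y * (2 * (\<eta> / (4 * Y)))" using Y by (intro mult_left_mono) (auto simp: \<zeta>_def)
    then show "Y * (2 * \<zeta>) \<le> \<eta> / 2" using Y by simp
  qed
  have Z: "Z > 0" using \<tau> D by (simp add: Z_def)
  have "((\<lambda>l::real. ln (2 * l) / l) \<longlongrightarrow> 0) at_top" by real_asymp
  then have e1: "\<forall>\<^sub>F l in at_top. ln (2 * l) / l < \<zeta>" by (rule order_tendstoD) (rule \<zeta>)
  have "((\<lambda>l::real. 2 * D * exp 2 * l * exp (- l / 8)) \<longlongrightarrow> 0) at_top" by real_asymp
  then have e2: "\<forall>\<^sub>F l in at_top. 2 * D * exp 2 * l * exp (- l / 8) < 2 * \<kappa>"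
    by (rule order_tendstoD) (use \<kappa> in simp)
  have "((\<lambda>l::real. 2 * exp (- \<epsilon> * l / 8)) \<longlongrightarrow> 0) at_top" using \<epsilon> by real_asymp
  then have e3: "\<forall>\<^sub>F l in at_top. 2 * exp (- \<epsilon> * l / 8) < c / 4"
    by (rule order_tendstoD) (use c in simp)
  have "\<forall>\<^sub>F l in at_top. l > 0 \<and> 4 * (1 + M) \<le> l \<and> 32 * (1 + M) * C\<^sup>2 / \<eta>\<^sup>2 \<le> l
     \<and> 2 * (Y * (2 + ln D)) / \<eta> \<le> l \<and> 8 / \<epsilon> \<le> l"
    by (intro eventually_conj eventually_ge_at_top eventually_gt_at_top)
  with e1 e2 e3 have "\<forall>\<^sub>F l in at_top. ln (2 * l) / l < \<zeta> \<and> 2 * D * exp 2 * l * exp (- l / 8) < 2 * \<kappa>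
     \<and> 2 * exp (- \<epsilon> * l / 8) < c / 4 \<and> l > 0 \<and> 4 * (1 + M) \<le> l \<and> 32 * (1 + M) * C\<^sup>2 / \<eta>\<^sup>2 \<le> l
     \<and> 2 * (Y * (2 + ln D)) / \<eta> \<le> l \<and> 8 / \<epsilon> \<le> l"
    by eventually_elim auto
  then obtain L where L: "\<And>l. L \<le> l \<Longrightarrow> ln (2 * l) / l < \<zeta> \<and> 2 * D * exp 2 * l * exp (- l / 8) < 2 * \<kappa>
     \<and> 2 * exp (- \<epsilon> * l / 8) < c / 4 \<and> l > 0 \<and> 4 * (1 + M) \<le> l \<and> 32 * (1 + M) * C\<^sup>2 / \<eta>\<^sup>2 \<le> l
     \<and> 2 * (Y * (2 + ln D)) / \<eta> \<le> l \<and> 8 / \<epsilon> \<le> l"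
    unfolding eventually_at_top_linorder by blast
  have "1 - 2 * sqrt c \<le> test_risk N n p q T"
    if pq: "0 < p" "p \<le> q" "q < 1" and n: "0 < n" "n < N" and p0c: "null_prob N n p q \<le> c0"
      and lL: "L \<le> ln (real N / real n)" and nl: "m * ln (real N / real n) \<le> real n"
      and np: "ln (max 1 (1 / (real n * p))) \<le> \<zeta> * ln (real N / real n)"
      and deg: "((q - p) / sqrt p * (real n powr (3/2) / real N powr (3/4)))\<^sup>2 \<le> Z"
      and H: "real n * bernoulli_entropy p q \<le> 2 * (1 - \<epsilon>) * ln (real N / real n)"
    for N n p q and T :: graph_test
  proof -
    define l where "l = ln (real N / real n)"
    define p0 where "p0 = null_prob N n p q"
    define \<gamma> where "\<gamma> = (q - p)\<^sup>2 / (p0 * (1 - p0))"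
    define \<theta> where "\<theta> = ln (q / p0) + ln ((1 - p0) / (1 - q))"
    define \<rho> where "\<rho> = num_pairs n / num_pairs N"
    note l = L[OF lL, folded l_def]
    note nl = nl[folded l_def] and np = np[folded l_def] and H = H[folded l_def]
    note p0 = null_prob_bounds[OF pq n(2), folded p0_def]
    have l0: "l > 0" using l by simp
    have H0: "0 \<le> bernoulli_entropy p q" by (rule bernoulli_entropy_nonneg[OF pq])
    have "2 * (1 - \<epsilon>) * l \<le> 2 * 1 * l" using \<epsilon> l0 by (intro mult_right_mono mult_left_mono) auto
    then have H2: "real n * bernoulli_entropy p q \<le> 2 * l" using H by simp
    have sq: "(q - p)\<^sup>2 \<le> 2 * q * bernoulli_entropy p q"
    proof -
      have "(q - p)\<^sup>2 \<le> 2 * q * (1 - p) * bernoulli_entropy p q" by (rule bernoulli_entropy_ge_square[OF pq])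
      also have "\<dots> \<le> 2 * q * 1 * bernoulli_entropy p q"
        using pq H0 by (intro mult_right_mono mult_left_mono) auto
      finally show ?thesis by simp
    qed
    \<comment> \<open>The entropy condition gives \<open>(q - p)\<^sup>2 \<le> 4 * l / n\<close>, so
      a large \<open>n / l\<close> forces \<open>q - p \<le> (1 - c0) / 2\<close>. Together with
      \<open>p \<le> p0 \<le> c0\<close> this keeps \<open>q\<close> away from
      \<open>1\<close>.\<close>
    have q1: "1 \<le> D * (1 - q)"
    proof -
      have "real n * (q - p)\<^sup>2 \<le> real n * (2 * q * bernoulli_entropy p q)" by (intro mult_left_mono sq) auto
      also have "\<dots> = 2 * q * (real n * bernoulli_entropy p q)" by simp
      also have "\<dots> \<le> 2 * 1 * (2 * l)" by (rule mult_mono[OF _ H2]) (use pq H0 in auto)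
      also have "\<dots> = ((1 - c0) / 2)\<^sup>2 * (m * l)" using c0 by (simp add: m_def power_divide)
      also have "\<dots> \<le> ((1 - c0) / 2)\<^sup>2 * real n" by (intro mult_left_mono nl) auto
      finally have "(q - p)\<^sup>2 \<le> ((1 - c0) / 2)\<^sup>2" using n by (simp add: mult.commute)
      then have "q - p \<le> (1 - c0) / 2" using c0 by (intro power2_le_imp_le[of "q - p"]) auto
      then have "(1 - c0) / 2 \<le> 1 - q" using p0 p0c unfolding p0_def by simp
      then show ?thesis using c0 by (simp add: D_def field_simps)
    qed
    have ln2: "ln (2 * l) \<le> \<zeta> * l" using l l0 by (simp add: pos_divide_less_eq less_imp_le)
    have ratio: "ln (q / p) \<le> 2 + 2 * \<zeta> * l"
      by (rule log_ratio_le[OF pq n(1) l0 H2 np ln2 \<zeta>(1)])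
    have "\<exists>y. \<theta> * y \<le> \<eta> * l \<and> (\<forall>k. 1 \<le> k \<longrightarrow> k \<le> n \<longrightarrow> ln (real n / real k) \<le> l / 4 \<longrightarrow>
      (\<exists>s\<ge>0. - s * (q * num_pairs k + y * real k) + q * num_pairs k * (exp s - 1)
              \<le> - (real k * (1 + ln (real n / real k) + M))))"
      unfolding \<theta>_def
    proof (rule truncation_slack_exists[where D = D and \<zeta> = \<zeta> and p = p])
      show "32 * (1 + M) * (1 + D)\<^sup>2 / \<eta>\<^sup>2 \<le> l" using l unfolding C_def by simp
      have "2 * (Y * (2 + ln D)) / \<eta> \<le> l" using l by simp
      then have "Y * (2 + ln D) \<le> \<eta> / 2 * l" using \<eta> by (simp add: pos_divide_le_eq mult.commute)
      then show "2 * (1 + 4 * (1 + D) * exp 4 / (\<eta> / (1 + D) * \<eta>)) *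
         (2 + 4 * (1 + D) * exp 4 / (\<eta> / (1 + D) * \<eta>) + M) * (2 + ln D) \<le> \<eta> / 2 * l"
        unfolding Y_def A_def \<eta>1_def C_def .
      show "2 * (1 + 4 * (1 + D) * exp 4 / (\<eta> / (1 + D) * \<eta>)) *
         (2 + 4 * (1 + D) * exp 4 / (\<eta> / (1 + D) * \<eta>) + M) * (2 * \<zeta>) \<le> \<eta> / 2"
        using \<zeta>(3) unfolding Y_def A_def \<eta>1_def C_def .
    qed (use pq p0 n q1 D \<eta> M H2 l ratio in auto)
    then obtain y where y: "\<theta> * y \<le> \<eta> * l"
      and tail: "\<And>k. 1 \<le> k \<Longrightarrow> k \<le> n \<Longrightarrow> ln (real n / real k) \<le> l / 4 \<Longrightarrow>
        \<exists>s\<ge>0. - s * (q * num_pairs k + y * real k) + q * num_pairs k * (exp s - 1)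
              \<le> - (real k * (1 + ln (real n / real k) + M))" by blast
    have \<gamma>: "0 \<le> \<gamma>" "\<gamma> \<le> D / 2 * ((q - p)\<^sup>2 / p)"
    proof -
      show "0 \<le> \<gamma>" using p0 by (simp add: \<gamma>_def)
      have "p * (1 - c0) \<le> p0 * (1 - p0)" using pq p0 p0c c0 unfolding p0_def by (intro mult_mono) auto
      then have "\<gamma> \<le> (q - p)\<^sup>2 / (p * (1 - c0))"
        unfolding \<gamma>_def using pq c0 p0 by (intro divide_left_mono mult_pos_pos) auto
      also have "\<dots> = D / 2 * ((q - p)\<^sup>2 / p)" using c0 pq by (simp add: D_def field_simps)
      finally show "\<gamma> \<le> D / 2 * ((q - p)\<^sup>2 / p)" .
    qed
    \<comment> \<open>Up to constants \<open>\<gamma> n\<close> is at most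
      \<open>(q / p) * l\<close>, hence of order \<open>l * exp (l / 8)\<close>, and the cut
      contributes \<open>exp (- l / 4)\<close>.\<close>
    have \<gamma>n: "\<gamma> * (real n * exp (- l / 4)) < 2 * \<kappa>"
    proof -
      have "q / p \<le> exp (2 + 2 * \<zeta> * l)"
        using ratio pq exp_le_cancel_iff[of "ln (q / p)" "2 + 2 * \<zeta> * l"] by simp
      also have "\<dots> \<le> exp (2 + l / 8)" using \<zeta> l0 mult_right_mono[of \<zeta> "1 / 16" l] by simp
      finally have qp: "q / p \<le> exp (2 + l / 8)" .
      have "\<gamma> * real n \<le> D / 2 * ((q - p)\<^sup>2 / p) * real n" by (intro mult_right_mono \<gamma>) auto
      also have "\<dots> \<le> D / 2 * (2 * q * bernoulli_entropy p q / p) * real n"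
        using D pq by (intro mult_right_mono mult_left_mono divide_right_mono sq) auto
      also have "\<dots> = D * (q / p) * (real n * bernoulli_entropy p q)" by simp
      also have "\<dots> \<le> D * exp (2 + l / 8) * (2 * l)"
        by (rule mult_mono[OF mult_left_mono[OF qp] H2]) (use D H0 in auto)
      finally have "\<gamma> * real n * exp (- l / 4) \<le> D * exp (2 + l / 8) * (2 * l) * exp (- l / 4)"
        by (intro mult_right_mono) auto
      also have "\<dots> = 2 * D * l * (exp (2 + l / 8) * exp (- l / 4))" by simp
      also have "exp (2 + l / 8) * exp (- l / 4) = exp 2 * exp (- l / 8)"
        unfolding exp_add[symmetric] by simp
      finally show ?thesis using l by (simp add: mult_ac)
    qed
    show ?thesis
    proof (rule test_risk_ge[OF pq n c d, where M = M and y = y and \<epsilon> = \<epsilon> and \<tau> = \<tau> and \<kappa> = \<kappa>,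
          folded l_def p0_def, folded \<gamma>_def \<theta>_def \<rho>_def])
      fix k assume k: "k \<le> n" "real n * exp (- l / 4) < real k"
      have k0: "0 < real k" using k(2) by (rule order.strict_trans1[rotated]) simp
      show "\<exists>s\<ge>0. - s * (q * num_pairs k + y * real k) + q * num_pairs k * (exp s - 1)
              \<le> - (real k * (1 + ln (real n / real k) + M))"
      proof (rule tail)
        have "real n / real k \<le> exp (l / 4)"
          using k k0 by (simp add: exp_minus field_simps)
        then show "ln (real n / real k) \<le> l / 4"
          using n k0 ln_le_cancel_iff[of "real n / real k" "exp (l / 4)"] by simp
      qed (use k k0 in auto)
      have kn: "num_pairs k \<le> real k * (real n / 2)"
        using num_pairs_le[of k] mult_left_mono[of "real k" "real n" "real k"] k by (simp add: power2_eq_square)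
      have "num_pairs k * bernoulli_entropy p0 q \<le> (real k ^ 2 / 2) * bernoulli_entropy p q"
        using num_pairs_le num_pairs_nonneg bernoulli_entropy_antimono[OF pq(1) p0(1,2) pq(3)]
          bernoulli_entropy_nonneg[OF p0(3,2) pq(3)]
        by (intro mult_mono) auto
      also have "\<dots> = real k * (real k / real n) / 2 * (real n * bernoulli_entropy p q)"
        using n by (simp add: power2_eq_square)
      also have "\<dots> \<le> real k * (real k / real n) / 2 * (2 * (1 - \<epsilon>) * l)"
        by (intro mult_left_mono H) auto
      also have "\<dots> = real k * (l * ((1 - \<epsilon>) * (real k / real n)))" using n by (simp add: field_simps)
      finally have cost1: "num_pairs k * bernoulli_entropy p0 q \<le> real k * (l * ((1 - \<epsilon>) * (real k / real n)))" .
      have cost2: "\<theta> * y * real k \<le> real k * (\<epsilon> / 16 * l)"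
        using mult_left_mono[OF y, of "real k"] by (simp add: \<eta>_def mult_ac)
      \<comment> \<open>In fact \<open>\<rho> \<le> exp (- l)\<close>; the weaker form lets
        \<open>\<gamma>n\<close> bound the \<open>\<rho>\<close> term as well.\<close>
      have \<rho>: "0 \<le> \<rho>" "\<rho> \<le> exp (- l / 4)"
      proof -
        show "0 \<le> \<rho>" unfolding \<rho>_def using num_pairs_nonneg by (intro divide_nonneg_nonneg)
        have "\<rho> \<le> real n / real N"
        proof -
          have "real n * (real n - 1) * real N \<le> real n * (real N * (real N - 1))"
            using n mult_left_mono[of "(real n - 1) * real N" "(real N - 1) * real N" "real n"]
            by (simp add: mult_ac)
          then show ?thesis using n by (simp add: \<rho>_def num_pairs_def divide_simps)
        qed
        also have "\<dots> = exp (- l)" unfolding l_def using n by (simp add: exp_minus)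
        also have "\<dots> \<le> exp (- l / 4)" using l0 by simp
        finally show "\<rho> \<le> exp (- l / 4)" .
      qed
      have "\<gamma> * \<rho> * num_pairs k \<le> \<gamma> * exp (- l / 4) * (real k * (real n / 2))"
        using \<gamma> \<rho> kn num_pairs_nonneg by (intro mult_mono mult_nonneg_nonneg) auto
      also have "\<dots> = real k * (\<gamma> * (real n * exp (- l / 4)) / 2)" by simp
      also have "\<dots> \<le> real k * (\<epsilon> / 16 * l)"
      proof (intro mult_left_mono)
        have "8 / \<epsilon> \<le> l" using l by simp
        then have "8 \<le> \<epsilon> * l" using \<epsilon> by (simp add: pos_divide_le_eq mult.commute)
        then show "\<gamma> * (real n * exp (- l / 4)) / 2 \<le> \<epsilon> / 16 * l" using \<gamma>n \<kappa> by simp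
      qed simp
      finally have cost3: "\<gamma> * \<rho> * num_pairs k \<le> real k * (\<epsilon> / 16 * l)" .
      have "real k * (l * ((1 - \<epsilon>) * (real k / real n) + \<epsilon> / 8))
          = real k * (l * ((1 - \<epsilon>) * (real k / real n))) + 2 * (real k * (\<epsilon> / 16 * l))"
        by (simp add: distrib_left)
      then show "num_pairs k * bernoulli_entropy p0 q + \<theta> * y * real k + \<gamma> * \<rho> * num_pairs k
        \<le> real k * (l * ((1 - \<epsilon>) * (real k / real n) + \<epsilon> / 8))"
        using cost1 cost2 cost3 by linarith
    next
      show "3 / 2 * \<gamma> * (real n ^ 2 / real N) * sqrt (real n ^ 2 / real N) \<le> \<tau>"
      proof -
        have powr_eq: "(real n powr (3/2) / real N powr (3/4))\<^sup>2 = real n ^ 2 / real N * sqrt (real n ^ 2 / real N)"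
          by (rule powr_ratio_square) (use n in auto)
        have "((q - p) / sqrt p)\<^sup>2 = (q - p)\<^sup>2 / p" using pq by (simp add: power_divide)
        then have "(q - p)\<^sup>2 / p * (real n ^ 2 / real N * sqrt (real n ^ 2 / real N)) \<le> Z"
          using deg unfolding power_mult_distrib powr_eq by simp
        then have "D / 2 * ((q - p)\<^sup>2 / p * (real n ^ 2 / real N * sqrt (real n ^ 2 / real N))) \<le> D / 2 * Z"
          using D by (intro mult_left_mono) auto
        moreover have "\<gamma> * (real n ^ 2 / real N * sqrt (real n ^ 2 / real N))
           \<le> D / 2 * ((q - p)\<^sup>2 / p) * (real n ^ 2 / real N * sqrt (real n ^ 2 / real N))"
          by (intro mult_right_mono \<gamma>) auto
        moreover have "D / 2 * Z = \<tau> / 3" using D by (simp add: Z_def)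
        ultimately have "\<gamma> * (real n ^ 2 / real N * sqrt (real n ^ 2 / real N)) \<le> \<tau> / 3"
          unfolding mult.assoc by linarith
        then have "3 / 2 * (\<gamma> * (real n ^ 2 / real N * sqrt (real n ^ 2 / real N))) \<le> \<tau>"
          using \<tau> by linarith
        then show ?thesis unfolding mult.assoc .
      qed
    qed (use \<epsilon> l \<tau> \<kappa> M \<gamma>n total in auto)
  qed
  then show ?thesis using that \<zeta>(1) Z by blast
qed

section \<open>The limit\<close>

text \<open>The trivial test supplies the upper half of the limit.\<close>

lemma test_risk_always_reject:
  assumes "n \<le> N"
  shows "test_risk N n p q (\<lambda>_. True) = 1"
proof -
  have "{1..n} \<in> {S. S \<subseteq> {1..N} \<and> card S = n}" using assms by auto
  then have "{S. S \<subseteq> {1..N} \<and> card S = n} \<noteq> {}" by blast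
  then have "(\<lambda>S. measure_pmf.prob (alt_law N p q S) {W. \<not> True}) ` {S. S \<subseteq> {1..N} \<and> card S = n} = {0}"
    by auto
  then show ?thesis unfolding test_risk_def by simp
qed

theorem theorem3:
  fixes n :: "nat \<Rightarrow> nat" and p0' p1 :: "nat \<Rightarrow> real"
  assumes params: "\<forall>\<^sub>F N in sequentially. 0 < p0' N \<and> p0' N \<le> p1 N \<and> p1 N < 1"
    and n_small: "(\<lambda>N. real (n N) / real N) \<longlonglongrightarrow> 0"
    and p0_away: "\<exists>c<1. \<forall>\<^sub>F N in sequentially. null_prob N (n N) (p0' N) (p1 N) \<le> c"
    and p0_large: "filterlim (\<lambda>N. real N ^ 2 * null_prob N (n N) (p0' N) (p1 N)) at_top sequentially"
    and n_large: "filterlim n at_top sequentially"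
    and p1_large: "filterlim (\<lambda>N. real (n N) ^ 2 * p1 N) at_top sequentially"
    and n_log: "filterlim (\<lambda>N. real (n N) / ln (real N)) at_top sequentially"
    and log_small: "(\<lambda>N. ln (max 1 (1 / (real (n N) * p0' N)))) \<in> o(\<lambda>N. ln (real N / real (n N)))"
    and total_degree:
      "(\<lambda>N. (p1 N - p0' N) / sqrt (p0' N) * (real (n N) powr (3/2) / real N powr (3/4))) \<longlonglongrightarrow> 0"
    and entropy:
      "limsup (\<lambda>N. ereal (real (n N) * bernoulli_entropy (p0' N) (p1 N)
                            / (2 * ln (real N / real (n N))))) < 1"
  shows "(\<lambda>N. INF T :: graph_test. test_risk N (n N) (p0' N) (p1 N) T) \<longlonglongrightarrow> 1"
proof (rule tendstoI)
  fix e :: real assume e: "e > 0"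
  obtain c1 where c1: "c1 < 1" "\<forall>\<^sub>F N in sequentially. null_prob N (n N) (p0' N) (p1 N) \<le> c1"
    using p0_away by blast
  define c0 where "c0 = max 0 c1"
  have ev_p0: "\<forall>\<^sub>F N in sequentially. null_prob N (n N) (p0' N) (p1 N) \<le> c0"
    using c1(2) by eventually_elim (simp add: c0_def)
  obtain z where z: "limsup (\<lambda>N. ereal (real (n N) * bernoulli_entropy (p0' N) (p1 N)
      / (2 * ln (real N / real (n N))))) < ereal z" "ereal z < 1"
    using ereal_dense2[OF entropy] by blast
  have ev_z: "\<forall>\<^sub>F N in sequentially. real (n N) * bernoulli_entropy (p0' N) (p1 N)
      / (2 * ln (real N / real (n N))) < z"
    using Limsup_lessD[OF z(1)] by simp
  define \<epsilon> where "\<epsilon> = min (1 / 2) (1 - z)"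
  have \<epsilon>: "0 < \<epsilon>" "\<epsilon> \<le> 1 / 2" "z \<le> 1 - \<epsilon>" using z(2) by (simp_all add: \<epsilon>_def min_def)
  \<comment> \<open>The excess \<open>(e / 4)\<^sup>2\<close> costs
    \<open>2 * sqrt ((e / 4)\<^sup>2) = e / 2\<close> in risk, leaving room for the strict
    inequality.\<close>
  obtain L \<zeta> m Z :: real where \<zeta>: "\<zeta> > 0" and Z: "Z > 0" and risk:
    "\<And>N n p q T. \<lbrakk>0 < p; p \<le> q; q < 1; 0 < n; n < N; null_prob N n p q \<le> c0;
        L \<le> ln (real N / real n); m * ln (real N / real n) \<le> real n;
        ln (max 1 (1 / (real n * p))) \<le> \<zeta> * ln (real N / real n);
        ((q - p) / sqrt p * (real n powr (3/2) / real N powr (3/4)))\<^sup>2 \<le> Z;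
        real n * bernoulli_entropy p q \<le> 2 * (1 - \<epsilon>) * ln (real N / real n)\<rbrakk>
      \<Longrightarrow> 1 - 2 * sqrt ((e / 4)\<^sup>2) \<le> test_risk N n p q T"
    by (rule test_risk_ge_of_parameters[of \<epsilon> c0 "(e / 4)\<^sup>2"]) (use \<epsilon> c1 e in \<open>auto simp: c0_def\<close>)
  have ev_n: "\<forall>\<^sub>F N in sequentially. 0 < n N"
    using eventually_compose_filterlim[OF eventually_gt_at_top n_large] .
  \<comment> \<open>The bound \<open>1\<close> gives \<open>n N < N\<close>, and
    \<open>exp (- L)\<close> gives \<open>L \<le> ln (N / n)\<close>.\<close>
  have ev_nN: "\<forall>\<^sub>F N in sequentially. real (n N) / real N < min 1 (exp (- L))"
    by (rule order_tendstoD(2)[OF n_small]) simp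
  have ev_m: "\<forall>\<^sub>F N in sequentially. max 0 m \<le> real (n N) / ln (real N)"
    using n_log unfolding filterlim_at_top by blast
  have ev_log: "\<forall>\<^sub>F N in sequentially. norm (ln (max 1 (1 / (real (n N) * p0' N)))) \<le> \<zeta> * norm (ln (real N / real (n N)))"
    by (rule landau_o.smallD[OF log_small \<zeta>])
  have "(\<lambda>N. ((p1 N - p0' N) / sqrt (p0' N) * (real (n N) powr (3/2) / real N powr (3/4)))\<^sup>2) \<longlonglongrightarrow> 0\<^sup>2"
    by (intro tendsto_power total_degree)
  then have ev_deg: "\<forall>\<^sub>F N in sequentially.
      ((p1 N - p0' N) / sqrt (p0' N) * (real (n N) powr (3/2) / real N powr (3/4)))\<^sup>2 < Z"
    by (rule order_tendstoD) (use Z in simp)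
  show "\<forall>\<^sub>F N in sequentially. dist (INF T. test_risk N (n N) (p0' N) (p1 N) T) 1 < e"
    using params ev_p0 ev_z ev_n ev_nN ev_m ev_log ev_deg eventually_gt_at_top[of 1]
  proof eventually_elim
    case (elim N)
    have n: "0 < n N" "0 < real N" "n N < N" using elim by (auto simp: divide_less_eq_1)
    have l0: "ln (real N / real (n N)) > 0" using n by (intro ln_gt_zero) auto
    have lL: "L \<le> ln (real N / real (n N))"
    proof -
      have "real (n N) / real N \<le> exp (- L)" using elim by simp
      then have "ln (real (n N) / real N) \<le> ln (exp (- L))" using n by (subst ln_le_cancel_iff) auto
      then show ?thesis using n by (simp add: ln_div)
    qed
    have nl: "m * ln (real N / real (n N)) \<le> real (n N)"
    proof -
      have "m * ln (real N / real (n N)) \<le> max 0 m * ln (real N / real (n N))"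
        using l0 by (intro mult_right_mono) auto
      also have "\<dots> \<le> max 0 m * ln (real N)"
        using n by (intro mult_left_mono) (auto simp: ln_div)
      also have "\<dots> \<le> real (n N)" using elim by (simp add: pos_le_divide_eq)
      finally show ?thesis .
    qed
    have logs: "ln (max 1 (1 / (real (n N) * p0' N))) \<le> \<zeta> * ln (real N / real (n N))"
      using elim l0 by simp
    have H: "real (n N) * bernoulli_entropy (p0' N) (p1 N) \<le> 2 * (1 - \<epsilon>) * ln (real N / real (n N))"
    proof -
      have "real (n N) * bernoulli_entropy (p0' N) (p1 N) \<le> z * (2 * ln (real N / real (n N)))"
        using elim l0 by (simp add: pos_divide_less_eq)
      also have "\<dots> \<le> (1 - \<epsilon>) * (2 * ln (real N / real (n N)))"
        using \<epsilon> l0 by (intro mult_right_mono) auto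
      also have "\<dots> = 2 * (1 - \<epsilon>) * ln (real N / real (n N))" by simp
      finally show ?thesis .
    qed
    have lower: "1 - e / 2 \<le> test_risk N (n N) (p0' N) (p1 N) T" for T
      using risk[of "p0' N" "p1 N" "n N" N T] elim n lL nl logs H e by simp
    then have "1 - e / 2 \<le> (INF T. test_risk N (n N) (p0' N) (p1 N) T)"
      by (intro cINF_greatest) auto
    moreover have "(INF T. test_risk N (n N) (p0' N) (p1 N) T) \<le> test_risk N (n N) (p0' N) (p1 N) (\<lambda>_. True)"
      by (rule cINF_lower) (use lower in \<open>auto intro!: bdd_belowI2[where m = "1 - e / 2"]\<close>)
    ultimately show ?case
      using e n by (simp add: test_risk_always_reject dist_real_def)
  qed
qed

end
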